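(* Assume $\beta_j<-\frac{r_2}{r_1}$ for $j=1,2$. Consider, for each $h>0$ treated as a parameter, the linear ODE $$\frac{\kappa^2}{2}y^2v_{yy}(y,h)-r\,v(y,h)=-V(y,h),\qquad y\ge y_3(h),$$ together with the following conditions: (a) along the curve $y=y_3(h)$ as $h\to+\infty$ (so $y\to0$): $v_y(y,h)\to-\infty$ and $v(y,h)-yv_y(y,h)\to+\infty$; (b) along the curve $y=y_3(h)$ as $h\to+\infty$: $\frac{y^{1/(\beta_1-1)}}{v_y(y,h)}\to-c_\infty$ for some constant $c_\infty>0$; (c) for each $h$, as $y\to+\infty$: $v_y(y,h)\to0$, $y\,v_{yy}(y,h)\to0$ and $v(y,h)-yv_y(y,h)\to-\frac{k}{r\beta_2}(\lambda h)^{\beta_2}$; (d) (free boundary condition) $v_h(y,h)=0$ for $y=y_3(h)$; (e) (smooth fit) $v(\cdot,h)$ and $v_y(\cdot,h)$ are continuous across $y=y_1(h)$ and $y=y_2(h)$. Then this problem admits the unique solution $$v(y,h)=\begin{cases}C_2(h)y^{r_2}-\frac{k}{r\beta_2}(\lambda h)^{\beta_2},& y>y_1(h),\\ C_3(h)y^{r_1}+C_4(h)y^{r_2}+\frac{2}{\kappa^2\gamma_1(\gamma_1-r_1)(\gamma_1-r_2)}y^{\gamma_1}-\frac{\lambda h}{r}y,& y_2(h)\le y\le y_1(h),\\ C_5(h)y^{r_1}+C_6(h)y^{r_2}+\frac{1}{r\beta_1}((1-\lambda)h)^{\beta_1}-\frac hr y,& y_3(h)\le y<y_2(h),\end{cases}$$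 where $$\begin{aligned} C_2(h)&=C_4(h)+\tfrac{y_1(h)^{-r_2}}{r(r_1-r_2)}\Big(\tfrac{kr_1}{\beta_2}(\lambda h)^{\beta_2}+\tfrac{r_1r_2}{\gamma_1(\gamma_1-r_2)}y_1(h)^{\gamma_1}+\lambda hr_2y_1(h)\Big),\\ C_3(h)&=\tfrac{y_1(h)^{-r_1}}{r(r_1-r_2)}\Big(\tfrac{kr_2}{\beta_2}(\lambda h)^{\beta_2}+\tfrac{r_1r_2}{\gamma_1(\gamma_1-r_1)}y_1(h)^{\gamma_1}+\lambda hr_1y_1(h)\Big),\\ C_4(h)&=C_6(h)+\tfrac{y_2(h)^{-r_2}}{r(r_1-r_2)}\Big(\tfrac{r_1}{\beta_1}((1-\lambda)h)^{\beta_1}-\tfrac{r_1r_2}{\gamma_1(\gamma_1-r_2)}y_2(h)^{\gamma_1}+(1-\lambda)hr_2y_2(h)\Big),\\ C_5(h)&=C_3(h)+\tfrac{y_2(h)^{-r_1}}{r(r_1-r_2)}\Big(\tfrac{r_2}{\beta_1}((1-\lambda)h)^{\beta_1}-\tfrac{r_1r_2}{\gamma_1(\gamma_1-r_1)}y_2(h)^{\gamma_1}+(1-\lambda)hr_1y_2(h)\Big),\\ C_6(h)&=\int_h^{+\infty}(1-\lambda)^{(r_1-r_2)\beta_1}\,C_5'(s)\,s^{(r_1-r_2)(\beta_1-1)}\,ds. \end{aligned}$$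
   Context: Constants: $r>0$, $\mu>r$, $\sigma>0$, $\kappa=\frac{\mu-r}{\sigma}$, $k>0$, $\lambda\in(0,1)$, $0<\beta_1,\beta_2<1$. $r_1>1$ and $r_2<0$ are the roots of $\eta^2-\eta-\frac{2r}{\kappa^2}=0$; $\gamma_1=\frac{\beta_1}{\beta_1-1}<0$. Definition of $z(h)$, $w(h)$ for $h>0$: put $\psi_h(c)=\frac{(c-\lambda h)^{\beta_1}}{\beta_1}+\frac{k}{\beta_2}(\lambda h)^{\beta_2}-c\,(c-\lambda h)^{\beta_1-1}$ for $c\in(\lambda h,h]$. If $\psi_h(h)>0$, $z(h)$ is the unique zero of $\psi_h$ in $(\lambda h,h)$; if $\psi_h(h)\le0$, $z(h)=h$. Set $w(h)=z(h)-\lambda h$. Boundary curves ($y_1\ge y_2>y_3$): $y_1(h)=\frac{k(\lambda h)^{\beta_2}}{\beta_2z(h)}+\frac{w(h)^{\beta_1}}{\beta_1z(h)}$, $\ y_2(h)=\min\big(y_1(h),((1-\lambda)h)^{\beta_1-1}\big)$, $\ y_3(h)=(1-\lambda)^{\beta_1}h^{\beta_1-1}$. The function $V$ on $\{y\ge y_3(h)\}$: $V(y,h)=-\frac{k}{\beta_2}(\lambda h)^{\beta_2}$ if $y>y_1(h)$; $V(y,h)=-\frac{\beta_1-1}{\beta_1}y^{\frac{\beta_1}{\beta_1-1}}-\lambda hy$ if $y_2(h)\le y\le y_1(h)$; $V(y,h)=\frac1{\beta_1}((1-\lambda)h)^{\beta_1}-hy$ if $y_3(h)\le y<y_2(h)$.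 Convention: when $y_1(h)=y_2(h)$ (which happens exactly when $z(h)=h$) the middle region reduces to a point; the middle case is then void and the point $y=y_1(h)=y_2(h)$ is assigned to the third case (for $v$ this gives the same value).
   Formalization: Solutions v are also required to be jointly continuous in (y,h) on the domain y ≥ y_3(h); without this, uniqueness fails, since adding y^{r_2} for h<1 only keeps every condition, v_h at y=y_3(h) being a right derivative. *)

theory Defs
  imports "HOL-Analysis.Analysis"
begin

text \<open>
  The parameters are fixed only to keep the formulas readable: after the context
  block, every constant takes those parameters it depends on, in the order listed.
  Here \<open>lam\<close> is the habit ratio, \<open>\<kappa> = (\<mu> - r) / \<sigma>\<close>, and \<open>r1\<close>, \<open>r2\<close> are the roots of
  \<open>\<eta>\<^sup>2 - \<eta> - 2 * r / \<kappa>\<^sup>2\<close>.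
\<close>

context
  fixes r \<kappa> r1 r2 k lam \<beta>1 \<beta>2 :: real
begin

definition psi :: "real \<Rightarrow> real \<Rightarrow> real" where
  "psi h c = (c - lam * h) powr \<beta>1 / \<beta>1 + k / \<beta>2 * (lam * h) powr \<beta>2
             - c * (c - lam * h) powr (\<beta>1 - 1)"

definition zfun :: "real \<Rightarrow> real" where
  "zfun h = (if psi h h > 0 then (THE c. lam * h < c \<and> c < h \<and> psi h c = 0) else h)"

definition wfun :: "real \<Rightarrow> real" where
  "wfun h = zfun h - lam * h"

definition Y1 :: "real \<Rightarrow> real" where
  "Y1 h = k * (lam * h) powr \<beta>2 / (\<beta>2 * zfun h) + wfun h powr \<beta>1 / (\<beta>1 * zfun h)"

definition Y2 :: "real \<Rightarrow> real" where
  "Y2 h = min (Y1 h) (((1 - lam) * h) powr (\<beta>1 - 1))"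

definition Y3 :: "real \<Rightarrow> real" where
  "Y3 h = (1 - lam) powr \<beta>1 * h powr (\<beta>1 - 1)"

definition dom_yh :: "(real \<times> real) set" where
  "dom_yh = {(y, h). 0 < h \<and> Y3 h \<le> y}"

text \<open>
  When \<open>Y1 h = Y2 h\<close> the middle case is void and the point \<open>y = Y1 h\<close> belongs to the third
  case; this is the purpose of the conjunct \<open>Y2 h < Y1 h\<close>, here and in \<open>vsol\<close>. Only the values
  for \<open>Y3 h \<le> y\<close> are meaningful.
\<close>

definition Vfun :: "real \<Rightarrow> real \<Rightarrow> real" where
  "Vfun y h =
     (if y > Y1 h then - (k / \<beta>2) * (lam * h) powr \<beta>2
      else if Y2 h \<le> y \<and> Y2 h < Y1 h
        then - ((\<beta>1 - 1) / \<beta>1) * y powr (\<beta>1 / (\<beta>1 - 1)) - lam * h * y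
      else 1 / \<beta>1 * ((1 - lam) * h) powr \<beta>1 - h * y)"

text \<open>
  \<open>solves_off N v\<close>: the function \<open>v\<close>, continuous on \<open>dom_yh\<close>, solves the boundary value problem,
  where for each \<open>h\<close> the differential equation is required at all \<open>y \<ge> Y3 h\<close> outside \<open>N h\<close>.
  Thus \<open>N = (\<lambda>h. {})\<close> asks for the equation on the whole half-line, while
  \<open>N = (\<lambda>h. {Y1 h, Y2 h})\<close> asks for it inside each region only, with nothing but smooth fit
  across the two curves. The functions \<open>vy\<close> and \<open>vyy\<close> are the first and second derivatives in
  \<open>y\<close>, one-sided at \<open>y = Y3 h\<close>. Since \<open>Y3\<close> is decreasing, the derivative in \<open>h\<close> in the
  free boundary condition is the right derivative. Such a derivative says nothing about jumps
  of \<open>v\<close> from the left in \<open>h\<close>, so without the joint continuity of \<open>v\<close> there would be no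
  uniqueness.
\<close>

definition solves_off :: "(real \<Rightarrow> real set) \<Rightarrow> (real \<Rightarrow> real \<Rightarrow> real) \<Rightarrow> bool" where
  "solves_off N v \<longleftrightarrow>
     continuous_on dom_yh (\<lambda>(y, h). v y h) \<and>
     (\<exists>vy vyy :: real \<Rightarrow> real \<Rightarrow> real.
        (\<forall>h>0. \<forall>y\<ge>Y3 h. y \<notin> N h \<longrightarrow>
           ((\<lambda>x. v x h) has_real_derivative vy y h) (at y within {Y3 h..}) \<and>
           ((\<lambda>x. vy x h) has_real_derivative vyy y h) (at y within {Y3 h..}) \<and>
           \<kappa>\<^sup>2 / 2 * y\<^sup>2 * vyy y h - r * v y h = - Vfun y h) \<and>
        filterlim (\<lambda>h. vy (Y3 h) h) at_bot at_top \<and>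
        filterlim (\<lambda>h. v (Y3 h) h - Y3 h * vy (Y3 h) h) at_top at_top \<and>
        (\<exists>c>0. ((\<lambda>h. Y3 h powr (1 / (\<beta>1 - 1)) / vy (Y3 h) h) \<longlongrightarrow> - c) at_top) \<and>
        (\<forall>h>0. ((\<lambda>y. vy y h) \<longlongrightarrow> 0) at_top \<and>
               ((\<lambda>y. y * vyy y h) \<longlongrightarrow> 0) at_top \<and>
               ((\<lambda>y. v y h - y * vy y h) \<longlongrightarrow> - (k / (r * \<beta>2)) * (lam * h) powr \<beta>2) at_top) \<and>
        (\<forall>h>0. ((\<lambda>s. v (Y3 h) s) has_real_derivative 0) (at h within {s. (Y3 h, s) \<in> dom_yh})) \<and>
        (\<forall>h>0. \<forall>y\<in>{Y1 h, Y2 h}. isCont (\<lambda>x. v x h) y \<and> isCont (\<lambda>x. vy x h) y))"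

definition gam1 :: real where
  "gam1 = \<beta>1 / (\<beta>1 - 1)"

definition C3 :: "real \<Rightarrow> real" where
  "C3 h = Y1 h powr (- r1) / (r * (r1 - r2)) *
     (k * r2 / \<beta>2 * (lam * h) powr \<beta>2
      + r1 * r2 / (gam1 * (gam1 - r1)) * Y1 h powr gam1
      + lam * h * r1 * Y1 h)"

definition C5 :: "real \<Rightarrow> real" where
  "C5 h = C3 h + Y2 h powr (- r1) / (r * (r1 - r2)) *
     (r2 / \<beta>1 * ((1 - lam) * h) powr \<beta>1
      - r1 * r2 / (gam1 * (gam1 - r1)) * Y2 h powr gam1
      + (1 - lam) * h * r1 * Y2 h)"

definition C6_integrand :: "real \<Rightarrow> real" where
  "C6_integrand s =
     (1 - lam) powr ((r1 - r2) * \<beta>1) * deriv C5 s * s powr ((r1 - r2) * (\<beta>1 - 1))"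

definition C6 :: "real \<Rightarrow> real" where
  "C6 h = integral {h..} C6_integrand"

definition C4 :: "real \<Rightarrow> real" where
  "C4 h = C6 h + Y2 h powr (- r2) / (r * (r1 - r2)) *
     (r1 / \<beta>1 * ((1 - lam) * h) powr \<beta>1
      - r1 * r2 / (gam1 * (gam1 - r2)) * Y2 h powr gam1
      + (1 - lam) * h * r2 * Y2 h)"

definition C2 :: "real \<Rightarrow> real" where
  "C2 h = C4 h + Y1 h powr (- r2) / (r * (r1 - r2)) *
     (k * r1 / \<beta>2 * (lam * h) powr \<beta>2
      + r1 * r2 / (gam1 * (gam1 - r2)) * Y1 h powr gam1
      + lam * h * r2 * Y1 h)"

definition vsol :: "real \<Rightarrow> real \<Rightarrow> real" where
  "vsol y h =
     (if y > Y1 h then C2 h * y powr r2 - k / (r * \<beta>2) * (lam * h) powr \<beta>2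
      else if Y2 h \<le> y \<and> Y2 h < Y1 h
        then C3 h * y powr r1 + C4 h * y powr r2
             + 2 / (\<kappa>\<^sup>2 * gam1 * (gam1 - r1) * (gam1 - r2)) * y powr gam1
             - lam * h / r * y
      else C5 h * y powr r1 + C6 h * y powr r2
           + 1 / (r * \<beta>1) * ((1 - lam) * h) powr \<beta>1 - h / r * y)"

end

end

theory Submission
  imports Defs
begin

text \<open>
  \<^bold>\<open>Existence.\<close> In scaled variables everything reduces to one function: with \<open>c = h * (lam + x)\<close>
  one has \<open>psi h c = h powr \<beta>1 * (U h - G x)\<close>, where \<open>G\<close> is strictly decreasing. So \<open>zfun\<close> is
  obtained by truncating \<open>X h = G\<inverse> (U h)\<close> at \<open>1 - lam\<close>, and \<open>Y1\<close>, \<open>Y2\<close>, \<open>Y3\<close> are \<open>h powr (\<beta>1 - 1)\<close>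
  times bounded-below ratios. The function \<open>V\<close> is continuous in \<open>y\<close> across the curves, which is why
  smooth fit already yields the equation on the whole half-line, and why the derivatives of the boundary
  curves drop out of \<open>C5'\<close> (an envelope argument). In particular \<open>C5\<close> is differentiable also where
  the middle region closes up, although \<open>Y2\<close> need not be. One finds
  \<open>C5' h = delta h * h powr ((1 - \<beta>1) * (r1 - 1))\<close> with \<open>delta\<close> bounded, nonnegative and convergent at infinity;
  the bound on \<open>\<beta>1\<close> says exactly that \<open>(1 - \<beta>1) * r1 > 1\<close>, so that the integral defining \<open>C6\<close> converges
  and \<open>v\<^sub>y / h\<close> has a negative limit along \<open>y = Y3 h\<close>.

  \<^bold>\<open>Uniqueness.\<close> The difference of two solutions solves the homogeneous Euler equation with no kink, hence
  equals \<open>A h * y powr r1 + B h * y powr r2\<close>. The conditions at \<open>y \<rightarrow> \<infinity>\<close> force \<open>A = 0\<close>, the free boundary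
  condition gives \<open>B\<close> right derivative zero and joint continuity makes \<open>B\<close> continuous, hence constant. Since
  \<open>Y3 h powr (r2 - 1)\<close> grows faster than \<open>h\<close>, a nonzero \<open>B\<close> would contradict (a) or (b).
\<close>

section \<open>Calculus\<close>

text \<open>At each nearby point the difference quotient of \<open>f\<close> is that of
  \<open>f1\<close> or that of \<open>f2\<close>, and both converge to \<open>D\<close>. The
  branches may alternate in any pattern near \<open>x\<close>.\<close>

lemma DERIV_of_two_branches:
  fixes f f1 f2 :: "real \<Rightarrow> real"
  assumes d: "(f1 has_real_derivative D) (at x)" "(f2 has_real_derivative D) (at x)"
    and eq: "f1 x = f2 x"
    and ev: "\<forall>\<^sub>F t in nhds x. f t = f1 t \<or> f t = f2 t"
  shows "(f has_real_derivative D) (at x)"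
proof -
  have fx: "f x = f1 x"
    using eventually_nhds_x_imp_x[OF ev] eq by auto
  let ?q = "\<lambda>g t. (g t - g x) / (t - x) :: real"
  have q: "(?q f1 \<longlongrightarrow> D) (at x)" "(?q f2 \<longlongrightarrow> D) (at x)"
    using d by (auto simp: has_field_derivative_iff)
  have "\<forall>\<^sub>F t in at x. f t = f1 t \<or> f t = f2 t"
    using ev by (auto simp: eventually_at_filter elim: eventually_mono)
  then have "\<forall>\<^sub>F t in at x. dist (?q f t) D < e" if "e > 0" for e
    using tendstoD[OF q(1) that] tendstoD[OF q(2) that]
    by eventually_elim (use fx eq in auto)
  then show ?thesis
    unfolding has_field_derivative_iff by (rule tendstoI)
qed

lemma tail_integral_deriv:
  fixes f :: "real \<Rightarrow> real"
  assumes cont: "continuous_on {0<..} f" and int: "\<And>a. a > 0 \<Longrightarrow> f integrable_on {a..}" and h: "h > 0"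
  shows "((\<lambda>x. integral {x..} f) has_real_derivative - f h) (at h)"
proof -
  \<comment> \<open>A base point strictly below \<open>h\<close> makes \<open>h\<close> interior to
    the interval, so the fundamental theorem gives a two-sided derivative.\<close>
  define a where "a = h / 2"
  have a: "0 < a" "a < h" using h by (auto simp: a_def)
  have split: "integral {x..} f = integral {a..} f - integral {a..x} f" if x: "a \<le> x" for x
  proof -
    have "f integrable_on {a..x}"
      using a by (intro integrable_continuous_interval continuous_on_subset[OF cont]) auto
    moreover have "f integrable_on {x..}" using a x by (intro int) simp
    moreover have "{a..x} \<inter> {x..} = {x}" "{a..x} \<union> {x..} = {a..}" using x by auto
    ultimately show ?thesis
      using integral_Un[of f "{a..x}" "{x..}"] by simp
  qed
  have "((\<lambda>x. integral {a..x} f) has_real_derivative f h) (at h within {a..h + 1})"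
    using a by (intro integral_has_real_derivative continuous_on_subset[OF cont]) auto
  moreover have "at h within {a..h + 1} = at h"
    using a by (intro at_within_Icc_at) auto
  ultimately have "((\<lambda>x. integral {a..} f - integral {a..x} f) has_real_derivative - f h) (at h)"
    using DERIV_diff[OF DERIV_const, of "\<lambda>x. integral {a..x} f" "f h" h UNIV "integral {a..} f"] by simp
  then show ?thesis
  proof (rule has_field_derivative_transform_within_open[where S = "{a<..}"])
    show "integral {a..} f - integral {a..x} f = integral {x..} f" if "x \<in> {a<..}" for x
      using that by (intro split[symmetric]) simp
  qed (use a in auto)
qed

text \<open>The selector common to \<open>vsol\<close> and \<open>Vfun\<close>, with the convention
  for a void middle region built in, so that the solution, its two derivatives and the right-hand
  side all switch under the same conditions.\<close>

definition piecewise3 ::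
  "real \<Rightarrow> real \<Rightarrow> (real \<Rightarrow> real) \<Rightarrow> (real \<Rightarrow> real) \<Rightarrow> (real \<Rightarrow> real) \<Rightarrow> real \<Rightarrow> real" where
  "piecewise3 a c f1 f2 f3 y = (if y > a then f1 y else if c \<le> y \<and> c < a then f2 y else f3 y)"

text \<open>If \<open>c = a\<close> the middle formula is skipped and the outer two have to match
  directly; otherwise each neighbouring pair has to. It serves twice, for the solution and for its
  first derivative.\<close>

lemma piecewise3_deriv:
  assumes "c \<le> a"
    and d: "(f1 has_real_derivative g1 y) (at y)" "(f2 has_real_derivative g2 y) (at y)"
      "(f3 has_real_derivative g3 y) (at y)"
    and void: "c = a \<Longrightarrow> f1 a = f3 a \<and> g1 a = g3 a"
    and proper: "c < a \<Longrightarrow> f1 a = f2 a \<and> g1 a = g2 a \<and> f2 c = f3 c \<and> g2 c = g3 c"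
  shows "(piecewise3 a c f1 f2 f3 has_real_derivative piecewise3 a c g1 g2 g3 y) (at y)"
proof -
  let ?f = "piecewise3 a c f1 f2 f3" and ?g = "piecewise3 a c g1 g2 g3 y"
  have up: "\<forall>\<^sub>F t in nhds y. x < t" if "x < y" for x
    using that eventually_nhds_in_open[of "{x<..}" y] by simp
  have dn: "\<forall>\<^sub>F t in nhds y. t < x" if "y < x" for x
    using that eventually_nhds_in_open[of "{..<x}" y] by simp
  consider "y > a" | "y = a" "c < a" | "y = a" "c = a" | "y < a" "c < y" | "y = c" "c < a" | "y < c"
    using \<open>c \<le> a\<close> by linarith
  then show ?thesis
  proof cases
    case 1
    then have g: "?g = g1 y" using \<open>c \<le> a\<close> by (simp add: piecewise3_def)
    have "\<forall>\<^sub>F t in nhds y. ?f t = f1 t \<or> ?f t = f1 t"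
      using up[OF 1] by eventually_elim (auto simp: piecewise3_def)
    from DERIV_of_two_branches[OF d(1) d(1) refl this] show ?thesis
      using g by simp
  next
    case 2
    then have g: "?g = g2 y" using \<open>c \<le> a\<close> by (simp add: piecewise3_def)
    have "\<forall>\<^sub>F t in nhds y. ?f t = f1 t \<or> ?f t = f2 t"
      using up[OF \<open>c < a\<close>[folded \<open>y = a\<close>]] by eventually_elim (auto simp: piecewise3_def)
    moreover have "(f1 has_real_derivative g2 y) (at y)" "f1 y = f2 y" using d proper 2 by auto
    ultimately show ?thesis
      using DERIV_of_two_branches[OF _ d(2)] g by simp
  next
    case 3
    then have g: "?g = g3 y" using \<open>c \<le> a\<close> by (simp add: piecewise3_def)
    have "\<forall>\<^sub>F t in nhds y. ?f t = f1 t \<or> ?f t = f3 t"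
      using 3 by (auto simp: piecewise3_def)
    moreover have "(f1 has_real_derivative g3 y) (at y)" "f1 y = f3 y" using d void 3 by auto
    ultimately show ?thesis
      using DERIV_of_two_branches[OF _ d(3)] g by simp
  next
    case 4
    then have g: "?g = g2 y" using \<open>c \<le> a\<close> by (simp add: piecewise3_def)
    have "\<forall>\<^sub>F t in nhds y. ?f t = f2 t \<or> ?f t = f2 t"
      using up[OF 4(2)] dn[OF 4(1)] by eventually_elim (auto simp: piecewise3_def)
    from DERIV_of_two_branches[OF d(2) d(2) refl this] show ?thesis
      using g by simp
  next
    case 5
    then have g: "?g = g2 y" using \<open>c \<le> a\<close> by (simp add: piecewise3_def)
    have "\<forall>\<^sub>F t in nhds y. ?f t = f2 t \<or> ?f t = f3 t"
      using dn[OF \<open>c < a\<close>[folded \<open>y = c\<close>]] by eventually_elim (auto simp: piecewise3_def)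
    moreover have "(f3 has_real_derivative g2 y) (at y)" "f2 y = f3 y" using d proper 5 by auto
    ultimately show ?thesis
      using DERIV_of_two_branches[OF d(2)] g by simp
  next
    case 6
    then have g: "?g = g3 y" using \<open>c \<le> a\<close> by (simp add: piecewise3_def)
    have "\<forall>\<^sub>F t in nhds y. ?f t = f3 t \<or> ?f t = f3 t"
      using dn[OF 6] by eventually_elim (use \<open>c \<le> a\<close> in \<open>auto simp: piecewise3_def\<close>)
    from DERIV_of_two_branches[OF d(3) d(3) refl this] show ?thesis
      using g by simp
  qed
qed

text \<open>Clamping the arguments turns the case distinction into compositions with
  \<open>max\<close> and \<open>min\<close>: outside its own interval each summand is frozen at an
  endpoint value, which cancels. Joint continuity in \<open>y\<close> and \<open>h\<close> then
  follows without tracking how the curves move.\<close>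

lemma piecewise3_eq_sum:
  assumes "c \<le> a" "f1 a = f2 a" "f2 c = f3 c"
  shows "piecewise3 a c f1 f2 f3 y =
      f1 (max y a) + f2 (max c (min y a)) + f3 (min y c) - f2 a - f3 c"
  using assms by (auto simp: piecewise3_def max_def min_def)

lemma right_deriv_zero_const:
  fixes f :: "real \<Rightarrow> real"
  assumes ab: "a < b" and cont: "continuous_on {a..b} f"
    and d: "\<And>x. a \<le> x \<Longrightarrow> x < b \<Longrightarrow> (f has_real_derivative 0) (at x within {x..})"
  shows "f b = f a"
proof (rule ccontr)
  assume ne: "f b \<noteq> f a"
  \<comment> \<open>Half the mean slope of \<open>f\<close>, so that \<open>\<phi> x \<le> 0\<close>
    fails at \<open>b\<close>. At the last point \<open>s\<close> where it holds, \<open>f\<close>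
    would have to leave with slope at least \<open>e\<close>, against the vanishing right
    derivative.\<close>
  define e where "e = \<bar>f b - f a\<bar> / (2 * (b - a))"
  have e: "e > 0" using ne ab by (simp add: e_def)
  define \<phi> where "\<phi> x = \<bar>f x - f a\<bar> - e * (x - a)" for x
  have "\<bar>f b - f a\<bar> = e * (2 * (b - a))" unfolding e_def using ab by simp
  moreover have "0 < e * (b - a)" using e ab by simp
  ultimately have \<phi>b: "\<phi> b > 0"
    unfolding \<phi>_def by (simp add: algebra_simps)
  have c\<phi>: "continuous_on {a..b} \<phi>"
    unfolding \<phi>_def[abs_def] by (intro continuous_intros cont)
  let ?S = "{x \<in> {a..b}. \<phi> x \<le> 0}"
  have "closed ?S"
    by (rule continuous_on_closed_Collect_le[OF c\<phi> continuous_on_const closed_atLeastAtMost])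
  moreover have "bounded ?S"
    by (rule bounded_subset[OF bounded_closed_interval[of a b]]) auto
  ultimately have "compact ?S" by (simp add: compact_eq_bounded_closed)
  moreover have "a \<in> ?S" using ab by (simp add: \<phi>_def)
  ultimately obtain s where s: "s \<in> ?S" "\<And>x. x \<in> ?S \<Longrightarrow> x \<le> s"
    using compact_attains_sup[of ?S] by blast
  then have sb: "a \<le> s" "s < b" using \<phi>b by (auto simp: less_le)
  have big: "e * (x - s) < \<bar>f x - f s\<bar>" if "s < x" "x \<le> b" for x
  proof -
    have "\<phi> x > 0" using s(2)[of x] that sb by force
    then show ?thesis using s(1) by (auto simp: \<phi>_def algebra_simps)
  qed
  have "((\<lambda>x. (f x - f s) / (x - s)) \<longlongrightarrow> 0) (at s within {s..})"
    using d[OF sb] by (simp add: has_field_derivative_iff)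
  then have "\<forall>\<^sub>F x in at s within {s..}. dist ((f x - f s) / (x - s)) 0 < e"
    using e by (rule tendstoD)
  then obtain t where t: "t > 0" "\<And>x. x \<ge> s \<Longrightarrow> x \<noteq> s \<Longrightarrow> dist x s < t \<Longrightarrow> \<bar>(f x - f s) / (x - s)\<bar> < e"
    unfolding eventually_at by (auto simp: dist_real_def)
  define x where "x = min b (s + t / 2)"
  have x: "s < x" "x \<le> b" "dist x s < t" using t(1) sb by (auto simp: x_def dist_real_def)
  have "\<bar>f x - f s\<bar> < e * (x - s)"
    using t(2)[of x] x by (simp add: abs_divide pos_divide_less_eq)
  with big[OF x(1,2)] show False by simp
qed

text \<open>With \<open>s + t = 1\<close> the Euler operator factors:
  \<open>y\<^sup>2 * f'' + s * t * f\<close> is \<open>(y d/dy - s)\<close> applied to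
  \<open>g = y * f' - t * f\<close>. Hence \<open>y * g' = s * g\<close> and
  \<open>y powr (- s) * g\<close> is constant; continuity carries the constant across the finite set
  \<open>N\<close>. On \<open>A * y powr s + B * y powr t\<close> the invariant is
  \<open>(s - t) * A\<close>.\<close>

lemma euler_invariant:
  fixes f f' f'' :: "real \<Rightarrow> real"
  assumes st: "s + t = 1" and a: "a > 0" and N: "finite N"
    and cont: "continuous_on {a..} f" "continuous_on {a..} f'"
    and d: "\<And>y. y \<ge> a \<Longrightarrow> y \<notin> N \<Longrightarrow> (f has_real_derivative f' y) (at y within {a..})"
    and d': "\<And>y. y \<ge> a \<Longrightarrow> y \<notin> N \<Longrightarrow> (f' has_real_derivative f'' y) (at y within {a..})"
    and ode: "\<And>y. y \<ge> a \<Longrightarrow> y \<notin> N \<Longrightarrow> y\<^sup>2 * f'' y = - (s * t) * f y"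
    and y: "y \<ge> a"
  shows "y powr (- s) * (y * f' y - t * f y) = a powr (- s) * (a * f' a - t * f a)"
proof -
  let ?Q = "\<lambda>y. y powr (- s) * (y * f' y - t * f y)"
  have "?Q y = ?Q a"
  proof (rule has_derivative_zero_unique_strong_interval[OF N, where f = ?Q and a = a and b = y])
  show "continuous_on {a..y} ?Q"
    using a by (intro continuous_intros continuous_on_subset[OF cont(1)] continuous_on_subset[OF cont(2)]) auto
  fix x assume x: "x \<in> {a..y} - N"
  then have xa: "x \<ge> a" "x \<notin> N" and x0: "x > 0" using a by auto
  note D = DERIV_subset[OF d[OF xa], of "{a..y}"] and D' = DERIV_subset[OF d'[OF xa], of "{a..y}"]
  have P: "((\<lambda>x. x powr (- s)) has_real_derivative - s * x powr (- s - 1)) (at x within {a..y})"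
    using has_real_derivative_powr[OF x0] by (rule has_field_derivative_at_within)
  have "((\<lambda>y. y * f' y - t * f y) has_real_derivative (1 * f' x + f'' x * x) - t * f' x) (at x within {a..y})"
    by (intro DERIV_diff DERIV_mult DERIV_cmult DERIV_ident D D') auto
  from DERIV_mult[OF P this]
  have Q: "(?Q has_real_derivative - s * x powr (- s - 1) * (x * f' x - t * f x)
      + ((1 * f' x + f'' x * x) - t * f' x) * x powr (- s)) (at x within {a..y})" .
  have p: "x powr (- s) = x * x powr (- s - 1)" using x0 by (simp add: powr_mult_base)
  have t: "t = 1 - s" using st by simp
  have "- s * x powr (- s - 1) * (x * f' x - t * f x) + ((1 * f' x + f'' x * x) - t * f' x) * x powr (- s)
      = x powr (- s - 1) * (x\<^sup>2 * f'' x + s * t * f x)"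
    unfolding p t by (simp add: power2_eq_square algebra_simps)
  also have "\<dots> = 0" using ode[OF xa] by simp
  finally show "(?Q has_derivative (\<lambda>h. 0)) (at x within {a..y})"
    using Q by (simp add: has_field_derivative_def lambda_zero)
  qed (use y in auto)
  then show ?thesis .
qed

section \<open>Boundary curves in scaled variables\<close>

text \<open>The roots enter through Vieta's relations, in which form all computations use them;
  drift and volatility enter through \<open>\<kappa>\<close> alone.\<close>

locale dual_problem =
  fixes r \<kappa> k lam \<beta>1 \<beta>2 r1 r2 :: real
  assumes r_pos: "r > 0" and kappa_nz: "\<kappa> \<noteq> 0" and k_pos: "k > 0"
    and lam_pos: "0 < lam" and lam_less: "lam < 1"
    and b1_pos: "0 < \<beta>1" and b1_less: "\<beta>1 < 1" and b2_pos: "0 < \<beta>2" and b2_less: "\<beta>2 < 1"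
    and r1_gt: "r1 > 1" and r2_eq: "r2 = 1 - r1" and r1_r2: "r1 * r2 = - 2 * r / \<kappa>\<^sup>2"
    and b1_bound: "\<beta>1 < - r2 / r1"
begin

abbreviation "z \<equiv> zfun k lam \<beta>1 \<beta>2"
abbreviation "y1 \<equiv> Y1 k lam \<beta>1 \<beta>2"
abbreviation "y2 \<equiv> Y2 k lam \<beta>1 \<beta>2"
abbreviation "y3 \<equiv> Y3 lam \<beta>1"
abbreviation "\<gamma> \<equiv> gam1 \<beta>1"
abbreviation "c2 \<equiv> C2 r r1 r2 k lam \<beta>1 \<beta>2"
abbreviation "c3 \<equiv> C3 r r1 r2 k lam \<beta>1 \<beta>2"
abbreviation "c4 \<equiv> C4 r r1 r2 k lam \<beta>1 \<beta>2"
abbreviation "c5 \<equiv> C5 r r1 r2 k lam \<beta>1 \<beta>2"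
abbreviation "c6 \<equiv> C6 r r1 r2 k lam \<beta>1 \<beta>2"
abbreviation "V \<equiv> Vfun k lam \<beta>1 \<beta>2"
abbreviation "v\<^sub>0 \<equiv> vsol r \<kappa> r1 r2 k lam \<beta>1 \<beta>2"

text \<open>
  Here \<open>x = (c - lam * h) / h\<close>, so that \<open>psi h c = 0\<close> reads \<open>G x = U h\<close>. Solving for \<open>x\<close> on the whole
  half-line gives \<open>X\<close>, which unlike \<open>zfun\<close> is differentiable everywhere; \<open>m\<close> below is its truncation
  at \<open>1 - lam\<close>, the value for \<open>c = h\<close>.
\<close>

definition G :: "real \<Rightarrow> real" where
  "G x = lam * x powr (\<beta>1 - 1) - (1 / \<beta>1 - 1) * x powr \<beta>1"

definition U :: "real \<Rightarrow> real" where
  "U h = k * lam powr \<beta>2 / \<beta>2 * h powr (\<beta>2 - \<beta>1)"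

definition Ginv :: "real \<Rightarrow> real" where
  "Ginv = the_inv_into {0<..} G"

definition X :: "real \<Rightarrow> real" where
  "X h = Ginv (U h)"

lemmas par = r_pos k_pos lam_pos lam_less b1_pos b1_less b2_pos b2_less r1_gt

lemma inv_b1: "1 / \<beta>1 > 1"
  using b1_pos b1_less by simp

lemma r2_neg: "r2 < 0" and r1_minus_r2: "r1 - r2 > 0"
  using r1_gt by (auto simp: r2_eq)

lemma U_pos: "h > 0 \<Longrightarrow> U h > 0"
  using par by (simp add: U_def)

section \<open>Monotonicity and inversion of \<open>G\<close>\<close>

lemma G_deriv: "x > 0 \<Longrightarrow>
    (G has_real_derivative (\<beta>1 - 1) * x powr (\<beta>1 - 2) * (lam + x)) (at x)"
  unfolding G_def[abs_def] using par
  by (auto intro!: derivative_eq_intros)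
    (auto simp: field_simps powr_diff power2_eq_square powr_add[symmetric] powr_mult_base)

lemma G_deriv_neg: "x > 0 \<Longrightarrow> (\<beta>1 - 1) * x powr (\<beta>1 - 2) * (lam + x) < 0"
  using par by (auto simp: mult_less_0_iff)

lemma G_strict: "0 < x \<Longrightarrow> x < x' \<Longrightarrow> G x' < G x"
  by (rule DERIV_neg_imp_decreasing[of x x' G]) (auto intro: G_deriv G_deriv_neg order.strict_trans2)

lemma G_less_iff: "0 < x \<Longrightarrow> 0 < x' \<Longrightarrow> G x' < G x \<longleftrightarrow> x < x'"
  using G_strict[of x x'] G_strict[of x' x] by (metis less_asym linorder_neqE_linordered_idom)

lemma G_inj: "inj_on G {0<..}"
  by (metis G_less_iff greaterThan_iff inj_onI less_irrefl linorder_neqE_linordered_idom)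

text \<open>Intermediate values between the zero \<open>a\<close> of \<open>G\<close> and a point
  near the origin, where the negative power dominates. The value \<open>u = 0\<close> is included
  because \<open>Ginv 0\<close> is the limit of \<open>X\<close> at infinity when
  \<open>\<beta>2 < \<beta>1\<close>.\<close>

lemma G_onto: "u \<ge> 0 \<Longrightarrow> \<exists>x>0. G x = u"
proof -
  assume u: "u \<ge> 0"
  define a where "a = lam / (1 / \<beta>1 - 1)"
  \<comment> \<open>Chosen so that \<open>t powr (\<beta>1 - 1) = 2 * u / lam + 1\<close>; for
    \<open>s \<le> a / 2\<close> the other factor of \<open>G s\<close> is at least
    \<open>lam / 2\<close>, and the product is at least \<open>u\<close>.\<close>
  define t where "t = (2 * u / lam + 1) powr (1 / (\<beta>1 - 1))"
  define s where "s = min (a / 2) t"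
  have a: "a > 0" "(1 / \<beta>1 - 1) * a = lam" using inv_b1 lam_pos by (auto simp: a_def)
  have G_eq: "G x = x powr (\<beta>1 - 1) * (lam - (1 / \<beta>1 - 1) * x)" if "x > 0" for x
    using that by (simp add: G_def algebra_simps powr_mult_base)
  have pos: "2 * u / lam + 1 > 0" using u lam_pos by (simp add: add_nonneg_pos)
  then have t: "t > 0" by (simp add: t_def)
  have tp: "t powr (\<beta>1 - 1) = 2 * u / lam + 1"
    using pos b1_less by (simp add: t_def powr_powr)
  have s: "0 < s" "s \<le> a / 2" "s \<le> t" using a t by (auto simp: s_def)
  have "u \<le> (2 * u / lam + 1) * (lam / 2)"
    using lam_pos by (simp add: field_simps)
  also have "\<dots> \<le> s powr (\<beta>1 - 1) * (lam - (1 / \<beta>1 - 1) * s)"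
  proof (rule mult_mono)
    show "2 * u / lam + 1 \<le> s powr (\<beta>1 - 1)"
      unfolding tp[symmetric] using s b1_less by (intro powr_mono2') auto
    have "(1 / \<beta>1 - 1) * s \<le> (1 / \<beta>1 - 1) * (a / 2)"
      using s inv_b1 by (intro mult_left_mono) auto
    then show "lam / 2 \<le> lam - (1 / \<beta>1 - 1) * s" using a by simp
  qed (use lam_pos in auto)
  finally have 1: "u \<le> G s" using s by (simp add: G_eq)
  have 2: "G a \<le> u" using a u by (simp add: G_eq)
  have "\<exists>x. s \<le> x \<and> x \<le> a \<and> G x = u"
  proof (rule IVT2)
    show "\<forall>x. s \<le> x \<and> x \<le> a \<longrightarrow> isCont G x"
      using s(1) by (auto intro!: DERIV_isCont[OF G_deriv])
  qed (use 1 2 s a in auto)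
  then obtain x where "s \<le> x" "G x = u" by blast
  with s(1) show ?thesis by (intro exI[of _ x]) auto
qed

lemma Ginv: "u \<ge> 0 \<Longrightarrow> Ginv u > 0" "u \<ge> 0 \<Longrightarrow> G (Ginv u) = u"
  using G_onto[of u] the_inv_into_f_f[OF G_inj] by (auto simp: Ginv_def)

lemma Ginv_G: "x > 0 \<Longrightarrow> Ginv (G x) = x"
  using the_inv_into_f_f[OF G_inj] by (auto simp: Ginv_def)

text \<open>Inverse function theorem. Existence of a derivative is enough, as the speed at which the
  curves move will cancel from the derivative of \<open>C5\<close>.\<close>

lemma Ginv_deriv: "u \<ge> 0 \<Longrightarrow> \<exists>D. (Ginv has_real_derivative D) (at u)"
proof -
  assume u: "u \<ge> 0"
  define D where "D = (\<beta>1 - 1) * Ginv u powr (\<beta>1 - 2) * (lam + Ginv u)"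
  have D: "D \<noteq> 0" using G_deriv_neg[of "Ginv u"] Ginv(1)[OF u] by (auto simp: D_def)
  have "(Ginv has_derivative (*) (inverse D)) (at u)"
  proof (rule has_derivative_inverse_strong_x)
    show "open {0::real<..}" "Ginv u \<in> {0<..}" "G (Ginv u) = u"
      using Ginv[OF u] by auto
    show "continuous_on {0<..} G"
      by (auto intro!: continuous_at_imp_continuous_on DERIV_isCont[OF G_deriv])
    show "(G has_derivative (*) D) (at (Ginv u))"
      using G_deriv[of "Ginv u"] Ginv(1)[OF u] by (simp add: has_field_derivative_def D_def)
    show "(*) D \<circ> (*) (inverse D) = id"
      using D by (auto simp: fun_eq_iff)
  qed (simp add: Ginv_G)
  then show ?thesis by (auto simp: has_field_derivative_def)
qed

lemma X_pos: "h > 0 \<Longrightarrow> X h > 0" and G_X: "h > 0 \<Longrightarrow> G (X h) = U h"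
  using Ginv[of "U h"] U_pos[of h] by (auto simp: X_def)

lemma X_deriv: "h > 0 \<Longrightarrow> \<exists>D. (X has_real_derivative D) (at h)"
proof -
  assume h: "h > 0"
  obtain D where D: "(Ginv has_real_derivative D) (at (U h))"
    using Ginv_deriv[of "U h"] U_pos[OF h] by auto
  obtain E where E: "(U has_real_derivative E) (at h)"
    unfolding U_def[abs_def] using has_real_derivative_powr[OF h] DERIV_cmult by blast
  show ?thesis
    unfolding X_def[abs_def] using DERIV_chain2[OF D E] by blast
qed

lemma X_cont: "continuous_on {0<..} X"
  by (auto intro!: continuous_at_imp_continuous_on dest!: X_deriv intro: DERIV_isCont)

section \<open>Scaled boundary curves and their two regimes\<close>

definition m :: "real \<Rightarrow> real" where
  "m h = min (X h) (1 - lam)"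

text \<open>Since \<open>zfun h = h * (lam + m h)\<close> and \<open>wfun h = h * m h\<close>, this
  is \<open>Y1 h / h powr (\<beta>1 - 1)\<close>; likewise \<open>eta2\<close> for
  \<open>Y2\<close>.\<close>

definition eta1 :: "real \<Rightarrow> real" where
  "eta1 h = (U h + m h powr \<beta>1 / \<beta>1) / (lam + m h)"

definition eta2 :: "real \<Rightarrow> real" where
  "eta2 h = min (eta1 h) ((1 - lam) powr (\<beta>1 - 1))"

lemma m_pos: "h > 0 \<Longrightarrow> m h > 0" and m_le: "m h \<le> 1 - lam"
  using X_pos[of h] lam_less by (auto simp: m_def)

lemma K_eq: "h > 0 \<Longrightarrow> k / \<beta>2 * (lam * h) powr \<beta>2 = h powr \<beta>1 * U h"
  using par by (simp add: U_def powr_mult powr_diff)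

lemma psi_eq:
  assumes "h > 0" "x > 0"
  shows "psi k lam \<beta>1 \<beta>2 h (h * (lam + x)) = h powr \<beta>1 * (U h - G x)"
proof -
  have 1: "h * (lam + x) - lam * h = h * x" by (simp add: algebra_simps)
  have 2: "h * h powr (\<beta>1 - 1) = h powr \<beta>1" "x * x powr (\<beta>1 - 1) = x powr \<beta>1"
    using assms by (simp_all add: powr_mult_base)
  have "psi k lam \<beta>1 \<beta>2 h (h * (lam + x)) =
     h powr \<beta>1 * x powr \<beta>1 / \<beta>1 + h powr \<beta>1 * U h
       - (h * h powr (\<beta>1 - 1)) * (lam * x powr (\<beta>1 - 1) + x * x powr (\<beta>1 - 1))"
    unfolding psi_def K_eq[OF assms(1)] 1 using assms by (simp add: powr_mult algebra_simps)
  also have "\<dots> = h powr \<beta>1 * (U h - G x)"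
    unfolding 2 G_def by (simp add: algebra_simps)
  finally show ?thesis .
qed

text \<open>As \<open>G\<close> decreases strictly, \<open>psi h h > 0\<close> means
  \<open>X h < 1 - lam\<close>, so the truncation in \<open>m\<close> reproduces the case
  distinction in \<open>zfun\<close>. Injectivity of \<open>G\<close> gives the uniqueness behind
  the definite description.\<close>

lemma z_eq: assumes h: "h > 0" shows "z h = h * (lam + m h)"
proof -
  have psih: "psi k lam \<beta>1 \<beta>2 h h = h powr \<beta>1 * (G (X h) - G (1 - lam))"
    using psi_eq[OF h, of "1 - lam"] lam_less G_X[OF h] by simp
  show ?thesis
  proof (cases "X h < 1 - lam")
    case True
    have "G (1 - lam) < G (X h)" using True X_pos[OF h] by (intro G_strict)
    then have pos: "psi k lam \<beta>1 \<beta>2 h h > 0" unfolding psih using h by simp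
    have "(THE c. lam * h < c \<and> c < h \<and> psi k lam \<beta>1 \<beta>2 h c = 0) = h * (lam + X h)"
    proof (rule the_equality)
      show "lam * h < h * (lam + X h) \<and> h * (lam + X h) < h \<and> psi k lam \<beta>1 \<beta>2 h (h * (lam + X h)) = 0"
      proof (intro conjI)
        show "lam * h < h * (lam + X h)"
          using mult_pos_pos[OF h X_pos[OF h]] by (simp add: algebra_simps)
        show "h * (lam + X h) < h"
          using mult_strict_left_mono[of "lam + X h" 1 h] h True by simp
        show "psi k lam \<beta>1 \<beta>2 h (h * (lam + X h)) = 0"
          using psi_eq[OF h X_pos[OF h]] G_X[OF h] by simp
      qed
    next
      fix c assume c: "lam * h < c \<and> c < h \<and> psi k lam \<beta>1 \<beta>2 h c = 0"
      define x where "x = c / h - lam"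
      have x: "x > 0" "c = h * (lam + x)" using c h by (auto simp: x_def field_simps)
      have "G x = G (X h)" using psi_eq[OF h x(1)] x(2) c h G_X[OF h] by simp
      then have "x = X h" using Ginv_G[OF x(1)] Ginv_G[OF X_pos[OF h]] by (metis (no_types))
      then show "c = h * (lam + X h)" using x by simp
    qed
    then show ?thesis using pos True by (simp add: zfun_def m_def)
  next
    case False
    then have "\<not> psi k lam \<beta>1 \<beta>2 h h > 0"
      unfolding psih using G_less_iff[of "X h" "1 - lam"] X_pos[OF h] lam_less h
      by (simp add: zero_less_mult_iff)
    then show ?thesis using False by (simp add: zfun_def m_def min_def)
  qed
qed

lemma y1_eq: assumes h: "h > 0" shows "y1 h = h powr (\<beta>1 - 1) * eta1 h"
proof -
  have z: "lam + m h > 0" using m_pos[OF h] lam_pos by simp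
  have w: "wfun k lam \<beta>1 \<beta>2 h = h * m h"
    unfolding wfun_def z_eq[OF h] by (simp add: algebra_simps)
  have "y1 h = (k / \<beta>2 * (lam * h) powr \<beta>2 + (h * m h) powr \<beta>1 / \<beta>1) / z h"
    by (simp add: Y1_def w add_divide_distrib)
  also have "\<dots> = (h powr \<beta>1 / h) * eta1 h"
    unfolding K_eq[OF h] z_eq[OF h] eta1_def using h m_pos[OF h] z
    by (simp add: powr_mult field_simps)
  also have "h powr \<beta>1 / h = h powr (\<beta>1 - 1)"
    using h by (simp add: powr_diff)
  finally show ?thesis .
qed

lemma y2_eq: assumes h: "h > 0" shows "y2 h = h powr (\<beta>1 - 1) * eta2 h"
  unfolding Y2_def y1_eq[OF h] eta2_def using h lam_less
  by (simp add: powr_mult min_mult_distrib_left mult.commute)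

lemma y3_eq: "y3 h = h powr (\<beta>1 - 1) * (1 - lam) powr \<beta>1"
  by (simp add: Y3_def)

text \<open>The equation \<open>G (X h) = U h\<close> makes the numerator of \<open>eta1\<close> a
  multiple of \<open>lam + X h\<close>. Unscaled, this is
  \<open>Y1 h = wfun h powr (\<beta>1 - 1)\<close>.\<close>

lemma eta1_interior: assumes h: "h > 0" and "X h \<le> 1 - lam" shows "eta1 h = X h powr (\<beta>1 - 1)"
proof -
  have m: "m h = X h" using assms by (simp add: m_def)
  have "U h + X h powr \<beta>1 / \<beta>1 = X h powr (\<beta>1 - 1) * (lam + X h)"
    unfolding G_X[OF h, symmetric] using X_pos[OF h]
    by (simp add: G_def algebra_simps powr_mult_base)
  then show ?thesis using X_pos[OF h] lam_pos by (simp add: eta1_def m)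
qed

lemma eta1_corner: "1 - lam \<le> X h \<Longrightarrow> eta1 h = U h + (1 - lam) powr \<beta>1 / \<beta>1"
  by (simp add: eta1_def m_def min_def)

text \<open>The corner is the regime \<open>zfun h = h\<close>. There
  \<open>psi h h \<le> 0\<close>, that is \<open>U h \<le> G (1 - lam)\<close>, shows that
  \<open>Y1\<close> attains the minimum in \<open>Y2\<close>, so the middle region is void.\<close>

lemma corner_le: assumes h: "h > 0" and X: "1 - lam \<le> X h" shows "eta1 h \<le> (1 - lam) powr (\<beta>1 - 1)"
proof -
  have "U h \<le> G (1 - lam)"
    using G_less_iff[of "1 - lam" "X h"] X_pos[OF h] lam_less X G_X[OF h]
    by (cases "X h = 1 - lam") auto
  also have "\<dots> = lam * (1 - lam) powr (\<beta>1 - 1) + (1 - lam) powr \<beta>1 - (1 - lam) powr \<beta>1 / \<beta>1"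
    by (simp add: G_def algebra_simps)
  finally have "eta1 h \<le> lam * (1 - lam) powr (\<beta>1 - 1) + (1 - lam) powr \<beta>1"
    unfolding eta1_corner[OF X] by simp
  also have "(1 - lam) powr \<beta>1 = (1 - lam) * (1 - lam) powr (\<beta>1 - 1)"
    using lam_less by (simp add: powr_mult_base)
  finally show ?thesis by (simp add: algebra_simps)
qed

lemma corner_pow_less: "(1 - lam) powr \<beta>1 < (1 - lam) powr (\<beta>1 - 1)"
  using lam_pos lam_less by (intro powr_less_mono') auto

lemma eta2_interior: assumes h: "h > 0" and X: "X h < 1 - lam"
  shows "eta2 h = (1 - lam) powr (\<beta>1 - 1)" "eta2 h < eta1 h"
proof -
  have "(1 - lam) powr (\<beta>1 - 1) < X h powr (\<beta>1 - 1)"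
    using X X_pos[OF h] b1_less by (intro powr_less_mono2_neg) auto
  then show "eta2 h = (1 - lam) powr (\<beta>1 - 1)" "eta2 h < eta1 h"
    using eta1_interior[OF h] X by (auto simp: eta2_def)
qed

lemma eta2_corner: "h > 0 \<Longrightarrow> 1 - lam \<le> X h \<Longrightarrow> eta2 h = eta1 h"
  using corner_le by (simp add: eta2_def)

text \<open>A lower bound independent of \<open>h\<close>: it keeps \<open>Y1\<close> and
  \<open>Y2\<close> above \<open>Y3\<close> and the negative powers in \<open>delta\<close>
  bounded.\<close>

lemma eta1_gt: assumes h: "h > 0" shows "(1 - lam) powr \<beta>1 < eta1 h"
proof (cases "X h < 1 - lam")
  case True
  then show ?thesis using eta2_interior[OF h True] corner_pow_less by simp
next
  case False
  have "(1 - lam) powr \<beta>1 \<le> (1 - lam) powr \<beta>1 / \<beta>1"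
    using par by (simp add: field_simps)
  then show ?thesis using eta1_corner[of h] False U_pos[OF h] by auto
qed

lemma eta2_gt: assumes h: "h > 0" shows "(1 - lam) powr \<beta>1 < eta2 h"
  using eta1_gt[OF h] corner_pow_less by (simp add: eta2_def)

lemma eta1_pos: "h > 0 \<Longrightarrow> eta1 h > 0" and eta2_pos: "h > 0 \<Longrightarrow> eta2 h > 0"
  using eta1_gt[of h] eta2_gt[of h] by (smt (verit) powr_ge_zero)+

lemma U_le_eta1: assumes h: "h > 0" shows "U h \<le> eta1 h"
proof -
  have "U h * (lam + m h) \<le> U h * 1"
    using U_pos[OF h] m_le[of h] by (intro mult_left_mono) auto
  also have "\<dots> \<le> U h + m h powr \<beta>1 / \<beta>1" using b1_pos by simp
  finally show ?thesis
    unfolding eta1_def using m_pos[OF h] lam_pos by (simp add: pos_le_divide_eq)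
qed

lemma y_pos: "h > 0 \<Longrightarrow> y1 h > 0" "h > 0 \<Longrightarrow> y2 h > 0" "h > 0 \<Longrightarrow> y3 h > 0"
  using eta1_pos eta2_pos lam_less by (auto simp: y1_eq y2_eq y3_eq)

lemma y3_less_y2: "h > 0 \<Longrightarrow> y3 h < y2 h"
  using eta2_gt by (simp add: y2_eq y3_eq)

lemma y2_le_y1: "y2 h \<le> y1 h"
  by (simp add: Y2_def)

lemma U_cont: "continuous_on {0<..} U"
  unfolding U_def[abs_def] by (intro continuous_intros) auto

lemma eta1_cont: "continuous_on {0<..} eta1"
proof -
  have "m h \<noteq> 0" "lam + m h \<noteq> 0" if "h > 0" for h
    using m_pos[OF that] lam_pos by auto
  moreover have "continuous_on {0<..} m"
    unfolding m_def[abs_def] by (intro continuous_intros X_cont)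
  ultimately show ?thesis
    unfolding eta1_def[abs_def] using b1_pos by (intro continuous_intros U_cont) auto
qed

lemma eta2_cont: "continuous_on {0<..} eta2"
  unfolding eta2_def[abs_def] by (intro continuous_intros eta1_cont)

lemma y1_cont: "continuous_on {0<..} y1"
  by (subst continuous_on_cong[OF refl y1_eq]) (auto intro!: continuous_intros eta1_cont)

lemma y2_cont: "continuous_on {0<..} y2"
  by (subst continuous_on_cong[OF refl y2_eq]) (auto intro!: continuous_intros eta2_cont)

section \<open>Coefficients\<close>

text \<open>The bound on \<open>\<beta>1\<close> amounts to \<open>r2 < \<gamma>\<close>. Together
  with \<open>\<gamma> < 0\<close> it keeps the exponent \<open>\<gamma>\<close> away from both
  homogeneous exponents, so no denominator in the coefficients vanishes.\<close>

lemma gamma_props: "\<gamma> < 0" "r2 < \<gamma>" "\<gamma> - r1 \<noteq> 0" "\<gamma> - r2 \<noteq> 0" "\<gamma> \<noteq> 0" "1 / \<gamma> = 1 - 1 / \<beta>1"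
    "(\<beta>1 - 1) * \<gamma> = \<beta>1"
proof -
  show g: "\<gamma> < 0" using par by (simp add: gam1_def divide_less_0_iff)
  have "\<beta>1 * r1 < r1 - 1"
    using b1_bound r1_gt by (simp add: r2_eq pos_less_divide_eq)
  then have "\<beta>1 < (r1 - 1) * (1 - \<beta>1)" by (simp add: algebra_simps)
  then have "\<beta>1 / (1 - \<beta>1) < r1 - 1" using b1_less by (simp add: pos_divide_less_eq)
  then show "r2 < \<gamma>"
    using b1_less by (simp add: gam1_def r2_eq minus_divide_right[symmetric] divide_minus_left[symmetric] field_simps)
  then show "\<gamma> - r2 \<noteq> 0" by simp
  show "\<gamma> - r1 \<noteq> 0" "\<gamma> \<noteq> 0" using g r1_gt by auto
  show "1 / \<gamma> = 1 - 1 / \<beta>1" "(\<beta>1 - 1) * \<gamma> = \<beta>1"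
    using par by (auto simp: gam1_def field_simps)
qed

lemma exponent_gt: "(1 - \<beta>1) * r1 > 1"
proof -
  have "\<beta>1 * r1 < r1 - 1"
    using b1_bound r1_gt by (simp add: r2_eq pos_less_divide_eq)
  then show ?thesis by (simp add: algebra_simps)
qed

text \<open>
  The last summand is the derivative with respect to the position \<open>y\<close> of the regime boundary.
  It is proportional to the jump of \<open>V\<close> there, so it will vanish.
\<close>

lemma coeff_deriv:
  assumes y: "(y has_real_derivative E * y h) (at h)" and pos: "y h > 0"
    and A: "(A has_real_derivative A') (at h)"
  shows "((\<lambda>s. y s powr (- r1) / (r * (r1 - r2)) *
             (r2 * A s + c * (r1 * r2 / (\<gamma> * (\<gamma> - r1))) * y s powr \<gamma> + l * s * r1 * y s))
     has_real_derivative
         y h powr (- r1) / (r * (r1 - r2)) * (r2 * A' + l * r1 * y h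
           + E * (r1 * r2) * (c * y h powr \<gamma> / \<gamma> + l * h * y h - A h))) (at h)"
proof -
  define q where "q = r1 * r2 / (\<gamma> * (\<gamma> - r1))"
  define W where "W = y h powr (- r1)"
  define Q where "Q = y h powr \<gamma>"
  \<comment> \<open>Differentiating the prefactor produces \<open>- r1 * q\<close>; what remains of
    \<open>\<gamma> * q\<close> is \<open>r1 * r2 / \<gamma>\<close>, the weight of the power term
    in the jump of \<open>V\<close>.\<close>
  have q: "q * \<gamma> = q * r1 + r1 * r2 / \<gamma>"
    using gamma_props by (simp add: q_def field_simps)
  have powr_deriv: "((\<lambda>s. y s powr e) has_real_derivative e * E * y h powr e) (at h)" for e
    by (rule DERIV_cong[OF DERIV_fun_powr[OF y pos]]) (use pos in \<open>simp add: powr_diff\<close>)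
  have dW: "((\<lambda>s. y s powr (- r1)) has_real_derivative - r1 * E * W) (at h)"
    and dQ: "((\<lambda>s. y s powr \<gamma>) has_real_derivative \<gamma> * E * Q) (at h)"
    unfolding W_def Q_def using powr_deriv[of "- r1"] powr_deriv[of \<gamma>] by auto
  let ?N = "r2 * A h + c * q * Q + l * h * r1 * y h"
  have "((\<lambda>s. l * s * r1) has_real_derivative l * r1) (at h)"
    by (auto intro!: derivative_eq_intros)
  from DERIV_add[OF DERIV_add[OF DERIV_cmult[OF A, of r2] DERIV_cmult[OF dQ, of "c * q"]] DERIV_mult[OF this y]]
  have dN: "((\<lambda>s. r2 * A s + c * q * y s powr \<gamma> + l * s * r1 * y s) has_real_derivative
       r2 * A' + c * q * (\<gamma> * E * Q) + (l * r1 * y h + l * h * r1 * (E * y h))) (at h)"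
    by (simp add: algebra_simps)
  have "((\<lambda>s. y s powr (- r1) / (r * (r1 - r2)) *
             (r2 * A s + c * q * y s powr \<gamma> + l * s * r1 * y s)) has_real_derivative
         (- r1 * E * W) / (r * (r1 - r2)) * ?N + W / (r * (r1 - r2)) *
           (r2 * A' + c * q * (\<gamma> * E * Q) + (l * r1 * y h + l * h * r1 * (E * y h)))) (at h)"
    using DERIV_mult[OF DERIV_cdivide[OF dW, of "r * (r1 - r2)"] dN]
    by (simp only: W_def Q_def mult.commute add.commute)
  also have "(- r1 * E * W) / (r * (r1 - r2)) * ?N + W / (r * (r1 - r2)) *
           (r2 * A' + c * q * (\<gamma> * E * Q) + (l * r1 * y h + l * h * r1 * (E * y h)))
    = W / (r * (r1 - r2)) * (- r1 * E * ?N +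
           (r2 * A' + c * E * Q * (q * \<gamma>) + (l * r1 * y h + l * h * r1 * (E * y h))))"
    by (simp add: algebra_simps)
  also have "- r1 * E * ?N +
           (r2 * A' + c * E * Q * (q * \<gamma>) + (l * r1 * y h + l * h * r1 * (E * y h)))
     = r2 * A' + l * r1 * y h + E * (r1 * r2) * (c * Q / \<gamma> + l * h * y h - A h)"
    unfolding q by (simp add: r2_eq algebra_simps diff_divide_distrib)
  finally show ?thesis unfolding q_def W_def Q_def .
qed

text \<open>\<open>PA\<close> and \<open>PB\<close> are the formulas for \<open>C3\<close> and
  \<open>C5 - C3\<close> with the position of the regime boundary left free, so that smooth
  continuations can be inserted for \<open>Y1\<close> and \<open>Y2\<close>. The explicit factors
  \<open>1\<close> and \<open>- 1\<close> fit the shape of \<open>coeff_deriv\<close>.\<close>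

definition PA :: "real \<Rightarrow> real \<Rightarrow> real" where
  "PA y h = y powr (- r1) / (r * (r1 - r2)) *
     (r2 * (k / \<beta>2 * (lam * h) powr \<beta>2) + 1 * (r1 * r2 / (\<gamma> * (\<gamma> - r1))) * y powr \<gamma> + lam * h * r1 * y)"

definition PB :: "real \<Rightarrow> real \<Rightarrow> real" where
  "PB y h = y powr (- r1) / (r * (r1 - r2)) *
     (r2 * (1 / \<beta>1 * ((1 - lam) * h) powr \<beta>1) + (- 1) * (r1 * r2 / (\<gamma> * (\<gamma> - r1))) * y powr \<gamma>
        + (1 - lam) * h * r1 * y)"

lemma c3_eq: "c3 h = PA (y1 h) h" and c5_eq: "c5 h = PA (y1 h) h + PB (y2 h) h"
  by (simp_all add: C3_def C5_def PA_def PB_def algebra_simps)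

text \<open>The derivative of \<open>C5\<close> computed with the positions \<open>Y1 h\<close> and
  \<open>Y2 h\<close> held fixed.\<close>

definition D5 :: "real \<Rightarrow> real" where
  "D5 h = y1 h powr (- r1) / (r * (r1 - r2)) * (r2 * (k * (lam * h) powr \<beta>2 / h) + lam * r1 * y1 h)
     + y2 h powr (- r1) / (r * (r1 - r2)) * (r2 * (((1 - lam) * h) powr \<beta>1 / h) + (1 - lam) * r1 * y2 h)"

lemma PA_deriv:
  assumes y: "(y has_real_derivative E * y h) (at h)" and pos: "y h > 0" and h: "h > 0"
  shows "((\<lambda>s. PA (y s) s) has_real_derivative
     y h powr (- r1) / (r * (r1 - r2)) * (r2 * (k * (lam * h) powr \<beta>2 / h) + lam * r1 * y h
           + E * (r1 * r2) * (1 * y h powr \<gamma> / \<gamma> + lam * h * y h - k / \<beta>2 * (lam * h) powr \<beta>2))) (at h)"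
  unfolding PA_def
proof (rule coeff_deriv[OF y pos])
  show "((\<lambda>s. k / \<beta>2 * (lam * s) powr \<beta>2) has_real_derivative k * (lam * h) powr \<beta>2 / h) (at h)"
    using par h by (auto intro!: derivative_eq_intros simp: powr_diff)
qed

lemma PB_deriv:
  assumes y: "(y has_real_derivative E * y h) (at h)" and pos: "y h > 0" and h: "h > 0"
  shows "((\<lambda>s. PB (y s) s) has_real_derivative
     y h powr (- r1) / (r * (r1 - r2)) * (r2 * (((1 - lam) * h) powr \<beta>1 / h) + (1 - lam) * r1 * y h
           + E * (r1 * r2) * ((- 1) * y h powr \<gamma> / \<gamma> + (1 - lam) * h * y h
               - 1 / \<beta>1 * ((1 - lam) * h) powr \<beta>1))) (at h)"
  unfolding PB_def
proof (rule coeff_deriv[OF y pos])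
  have "((\<lambda>s. ((1 - lam) * s) powr \<beta>1) has_real_derivative
      (1 - lam) * \<beta>1 * ((1 - lam) * h) powr (\<beta>1 - 1)) (at h)"
    using par h by (auto intro!: derivative_eq_intros)
  then have "((\<lambda>s. 1 / \<beta>1 * ((1 - lam) * s) powr \<beta>1) has_real_derivative
      1 / \<beta>1 * ((1 - lam) * \<beta>1 * ((1 - lam) * h) powr (\<beta>1 - 1))) (at h)"
    by (rule DERIV_cmult)
  also have "1 / \<beta>1 * ((1 - lam) * \<beta>1 * ((1 - lam) * h) powr (\<beta>1 - 1)) = ((1 - lam) * h) powr \<beta>1 / h"
    using par h by (simp add: powr_diff)
  finally show "((\<lambda>s. 1 / \<beta>1 * ((1 - lam) * s) powr \<beta>1) has_real_derivative
      ((1 - lam) * h) powr \<beta>1 / h) (at h)" .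
qed

section \<open>Differentiability of \<open>C5\<close> by the envelope argument\<close>

lemma logarithmic_deriv: "(f has_real_derivative D) (at h) \<Longrightarrow> f h > 0 \<Longrightarrow> \<exists>E. (f has_real_derivative E * f h) (at h)"
  by (intro exI[of _ "D / f h"]) simp

text \<open>
  Smooth continuations, beyond the point where the middle region closes up, of the curves on either side of it:
  \<open>(Y1, Y2) = (ya, yb)\<close> where \<open>X h \<le> 1 - lam\<close>, and \<open>Y1 = Y2 = ym\<close> otherwise.
\<close>

definition ya :: "real \<Rightarrow> real" where "ya s = (s * X s) powr (\<beta>1 - 1)"
definition yb :: "real \<Rightarrow> real" where "yb s = ((1 - lam) * s) powr (\<beta>1 - 1)"
definition ym :: "real \<Rightarrow> real" where "ym s = s powr (\<beta>1 - 1) * (U s + (1 - lam) powr \<beta>1 / \<beta>1)"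

lemma y_interior: "h > 0 \<Longrightarrow> X h \<le> 1 - lam \<Longrightarrow> y1 h = ya h \<and> y2 h = yb h"
  using eta2_interior[of h] eta1_interior[of h] X_pos[of h] lam_less
  by (auto simp: y1_eq y2_eq ya_def yb_def powr_mult mult.commute eta2_def le_less)

lemma y_corner: "h > 0 \<Longrightarrow> 1 - lam \<le> X h \<Longrightarrow> y1 h = ym h \<and> y2 h = ym h"
  using eta2_corner[of h] eta1_corner[of h] by (auto simp: y1_eq y2_eq ym_def)

text \<open>Continuity of \<open>V\<close> across \<open>Y1\<close> while the middle region is open;
  after scaling by \<open>h powr \<beta>1\<close> it is the equation
  \<open>G (X h) = U h\<close>.\<close>

lemma V_jump_ya: assumes h: "h > 0"
  shows "ya h powr \<gamma> / \<gamma> + lam * h * ya h = k / \<beta>2 * (lam * h) powr \<beta>2"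
proof -
  have a1: "ya h powr \<gamma> / \<gamma> = (h * X h) powr \<beta>1 * (1 - 1 / \<beta>1)"
    using gamma_props by (simp add: ya_def powr_powr divide_inverse)
  have a2: "lam * h * ya h = h powr \<beta>1 * (lam * X h powr (\<beta>1 - 1))"
    using h X_pos[OF h] by (simp add: ya_def powr_mult powr_mult_base)
  have a3: "k / \<beta>2 * (lam * h) powr \<beta>2 = h powr \<beta>1 * (lam * X h powr (\<beta>1 - 1) - (1 / \<beta>1 - 1) * X h powr \<beta>1)"
    using K_eq[OF h] G_X[OF h] by (simp add: G_def)
  show ?thesis
    unfolding a1 a2 a3 using h X_pos[OF h] by (simp add: powr_mult algebra_simps)
qed

lemma V_jump_yb: assumes h: "h > 0"
  shows "yb h powr \<gamma> / \<gamma> = (1 - lam) * h * yb h - 1 / \<beta>1 * ((1 - lam) * h) powr \<beta>1"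
proof -
  have "yb h powr \<gamma> / \<gamma> = ((1 - lam) * h) powr \<beta>1 * (1 - 1 / \<beta>1)"
    using gamma_props by (simp add: yb_def powr_powr divide_inverse)
  moreover have "(1 - lam) * h * yb h = ((1 - lam) * h) powr \<beta>1"
    using h lam_less by (simp add: yb_def powr_mult_base)
  ultimately show ?thesis
    by (simp add: algebra_simps)
qed

text \<open>With a void middle region the outer two formulas for \<open>V\<close> meet directly at
  \<open>ym h\<close>.\<close>

lemma V_jump_ym: assumes h: "h > 0"
  shows "h * ym h = k / \<beta>2 * (lam * h) powr \<beta>2 + 1 / \<beta>1 * ((1 - lam) * h) powr \<beta>1"
  unfolding K_eq[OF h]
  using h lam_less by (simp add: ym_def powr_mult powr_mult_base mult.assoc[symmetric])
    (simp add: algebra_simps)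

lemma interior_deriv:
  assumes h: "h > 0" and X: "X h \<le> 1 - lam"
  shows "((\<lambda>s. PA (ya s) s + PB (yb s) s) has_real_derivative D5 h) (at h)"
proof -
  have pos: "ya h > 0" "yb h > 0" using h X_pos[OF h] lam_less by (auto simp: ya_def yb_def)
  obtain DX where "(X has_real_derivative DX) (at h)" using X_deriv[OF h] by blast
  then have "\<exists>D. (ya has_real_derivative D) (at h)"
    unfolding ya_def[abs_def] using h X_pos[OF h]
    by (intro exI) (rule DERIV_fun_powr derivative_eq_intros refl | simp)+
  then obtain Ea where Ea: "(ya has_real_derivative Ea * ya h) (at h)"
    using logarithmic_deriv pos by blast
  have "\<exists>D. (yb has_real_derivative D) (at h)"
    unfolding yb_def[abs_def] using h lam_less
    by (intro exI) (rule DERIV_fun_powr derivative_eq_intros refl | simp)+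
  then obtain Eb where Eb: "(yb has_real_derivative Eb * yb h) (at h)"
    using logarithmic_deriv pos by blast
  have y: "y1 h = ya h" "y2 h = yb h" using y_interior[OF h X] by auto
  have za: "1 * ya h powr \<gamma> / \<gamma> + lam * h * ya h - k / \<beta>2 * (lam * h) powr \<beta>2 = 0"
    and zb: "(- 1) * yb h powr \<gamma> / \<gamma> + (1 - lam) * h * yb h - 1 / \<beta>1 * ((1 - lam) * h) powr \<beta>1 = 0"
    using V_jump_ya[OF h] V_jump_yb[OF h] by simp_all
  show ?thesis
    using DERIV_add[OF PA_deriv[OF Ea pos(1) h] PB_deriv[OF Eb pos(2) h]]
    unfolding za zb D5_def y by simp
qed

text \<open>The contributions of the two curves need not vanish separately here. Since the curves
  coincide, they carry the same weight and speed \<open>E\<close>, and only their sum counts, which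
  is zero by \<open>V_jump_ym\<close>.\<close>

lemma corner_deriv:
  assumes h: "h > 0" and X: "1 - lam \<le> X h"
  shows "((\<lambda>s. PA (ym s) s + PB (ym s) s) has_real_derivative D5 h) (at h)"
proof -
  have pos: "ym h > 0" using y_pos[OF h] y_corner[OF h X] by auto
  have "\<exists>D. (ym has_real_derivative D) (at h)"
    unfolding ym_def[abs_def] U_def using h
    by (intro exI) (rule DERIV_fun_powr derivative_eq_intros refl | simp)+
  then obtain E where E: "(ym has_real_derivative E * ym h) (at h)"
    using logarithmic_deriv pos by blast
  have y: "y1 h = ym h" "y2 h = ym h" using y_corner[OF h X] by auto
  have zero: "(1 * ym h powr \<gamma> / \<gamma> + lam * h * ym h - k / \<beta>2 * (lam * h) powr \<beta>2)
     + ((- 1) * ym h powr \<gamma> / \<gamma> + (1 - lam) * h * ym h - 1 / \<beta>1 * ((1 - lam) * h) powr \<beta>1) = 0"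
    using V_jump_ym[OF h] by (simp add: algebra_simps)
  have lin: "W * (a + E * R * s) + W * (b + E * R * t) = W * a + W * b" if "s + t = 0" for W a b R s t :: real
  proof -
    have "t = - s" using that by simp
    then show ?thesis by (simp add: algebra_simps)
  qed
  show ?thesis
    using DERIV_add[OF PA_deriv[OF E pos h] PB_deriv[OF E pos h]]
    unfolding lin[OF zero] D5_def y .
qed

text \<open>At \<open>X h = 1 - lam\<close> the two smooth continuations agree in value and, as
  \<open>D5 h\<close> depends only on the positions of the curves, also in derivative. A kink of
  \<open>Y2\<close> is therefore invisible to \<open>C5\<close>.\<close>

lemma c5_deriv: assumes h: "h > 0" shows "(c5 has_real_derivative D5 h) (at h)"
proof -
  let ?F1 = "\<lambda>s. PA (ya s) s + PB (yb s) s" and ?F2 = "\<lambda>s. PA (ym s) s + PB (ym s) s"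
  have nh: "\<forall>\<^sub>F s in nhds h. s > 0" using h eventually_nhds_in_open[of "{0<..}" h] by simp
  obtain DX where "(X has_real_derivative DX) (at h)" using X_deriv[OF h] by blast
  then have "isCont X h" by (rule DERIV_isCont)
  then have cX: "(X \<longlongrightarrow> X h) (nhds h)" by (simp add: continuous_at tendsto_at_iff_tendsto_nhds)
  have ev: "\<forall>\<^sub>F s in nhds h. (X s \<le> 1 - lam \<longrightarrow> c5 s = ?F1 s) \<and> (1 - lam \<le> X s \<longrightarrow> c5 s = ?F2 s)"
    using nh by eventually_elim (auto simp: c5_eq y_interior y_corner)
  consider "X h < 1 - lam" | "X h > 1 - lam" | "X h = 1 - lam" by linarith
  then show ?thesis
  proof cases
    case 1
    then have "\<forall>\<^sub>F s in nhds h. X s < 1 - lam" using order_tendstoD[OF cX] by auto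
    with ev have "\<forall>\<^sub>F s in nhds h. c5 s = ?F1 s \<or> c5 s = ?F1 s" by eventually_elim auto
    then show ?thesis
      by (rule DERIV_of_two_branches[OF interior_deriv interior_deriv refl, OF h less_imp_le[OF 1] h less_imp_le[OF 1]])
  next
    case 2
    then have "\<forall>\<^sub>F s in nhds h. X s > 1 - lam" using order_tendstoD[OF cX] by auto
    with ev have "\<forall>\<^sub>F s in nhds h. c5 s = ?F2 s \<or> c5 s = ?F2 s" by eventually_elim auto
    then show ?thesis
      by (rule DERIV_of_two_branches[OF corner_deriv corner_deriv refl, OF h less_imp_le[OF 2] h less_imp_le[OF 2]])
  next
    case 3
    have "?F1 h = ?F2 h" using y_interior[OF h] y_corner[OF h] 3 by (metis order.refl)
    moreover have "\<forall>\<^sub>F s in nhds h. c5 s = ?F1 s \<or> c5 s = ?F2 s" using ev by eventually_elim force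
    ultimately show ?thesis
      by (rule DERIV_of_two_branches[OF interior_deriv[OF h eq_refl[OF 3]] corner_deriv[OF h eq_refl[OF 3[symmetric]]]])
  qed
qed

section \<open>The scaled derivative of \<open>C5\<close> and its bounds\<close>

definition delta :: "real \<Rightarrow> real" where
  "delta h = (eta1 h powr (- r1) * (r2 * \<beta>2 * U h + lam * r1 * eta1 h)
     + eta2 h powr (- r1) * (r2 * (1 - lam) powr \<beta>1 + (1 - lam) * r1 * eta2 h)) / (r * (r1 - r2))"

lemma D5_eq: assumes h: "h > 0" shows "D5 h = delta h * h powr ((1 - \<beta>1) * (r1 - 1))"
proof -
  have K: "k * (lam * h) powr \<beta>2 / h = h powr (\<beta>1 - 1) * (\<beta>2 * U h)"
  proof -
    have "k * (lam * h) powr \<beta>2 / h = \<beta>2 * (k / \<beta>2 * (lam * h) powr \<beta>2) / h"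
      using b2_pos by simp
    then show ?thesis unfolding K_eq[OF h] using h by (simp add: powr_diff)
  qed
  have L: "((1 - lam) * h) powr \<beta>1 / h = h powr (\<beta>1 - 1) * (1 - lam) powr \<beta>1"
    using h lam_less by (simp add: powr_diff powr_mult)
  have W: "(h powr (\<beta>1 - 1) * e) powr (- r1) = h powr ((1 - \<beta>1) * r1) * e powr (- r1)" if "e > 0" for e
    using that h by (simp add: powr_mult powr_powr algebra_simps)
  have P: "h powr ((1 - \<beta>1) * r1) * h powr (\<beta>1 - 1) = h powr ((1 - \<beta>1) * (r1 - 1))"
    by (simp add: powr_add[symmetric] algebra_simps)
  have scale: "(q * w) / d * (r2 * (p * a) + l * r1 * (p * e)) = (q * p) * (w * (r2 * a + l * r1 * e) / d)"
    for q w d p a l e :: real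
    by (simp add: add_divide_distrib algebra_simps)
  have "D5 h = (h powr ((1 - \<beta>1) * r1) * h powr (\<beta>1 - 1)) * delta h"
    unfolding D5_def y1_eq[OF h] y2_eq[OF h] K L W[OF eta1_pos[OF h]] W[OF eta2_pos[OF h]]
      scale delta_def
    by (simp only: add_divide_distrib distrib_left mult.assoc)
  then show ?thesis unfolding P by simp
qed

lemma delta_cont: "continuous_on {0<..} delta"
proof -
  have "eta1 h \<noteq> 0" "eta2 h \<noteq> 0" if "h > 0" for h
    using eta1_pos[OF that] eta2_pos[OF that] by auto
  then show ?thesis
    unfolding delta_def[abs_def] using r_pos r1_minus_r2
    by (intro continuous_intros eta1_cont eta2_cont U_cont) auto
qed

text \<open>While the middle region is open, \<open>U h \<le> lam * eta1 h\<close> and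
  \<open>- r2 < r1\<close> make both summands nonnegative. In the corner it is their sum that is
  estimated, which works because \<open>eta1 h = eta2 h\<close> gives them the same weight. The sign
  passes to the limit of \<open>delta\<close>, where it decides the signs in the boundary
  asymptotics.\<close>

lemma delta_nonneg: assumes h: "h > 0" shows "delta h \<ge> 0"
proof -
  have e: "eta1 h > 0" "eta2 h > 0" "U h > 0" using eta1_pos eta2_pos U_pos h by auto
  have "0 \<le> eta1 h powr (- r1) * (r2 * \<beta>2 * U h + lam * r1 * eta1 h)
     + eta2 h powr (- r1) * (r2 * (1 - lam) powr \<beta>1 + (1 - lam) * r1 * eta2 h)"
  proof (cases "X h < 1 - lam")
    case True
    have "U h \<le> lam * eta1 h"
      unfolding G_X[OF h, symmetric] eta1_interior[OF h less_imp_le[OF True]] G_def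
      using inv_b1 by simp
    moreover have "\<beta>2 * U h \<le> U h" using e b2_less by simp
    ultimately have "- r2 * (\<beta>2 * U h) \<le> - r2 * (lam * eta1 h)"
      using r2_neg by (intro mult_left_mono) auto
    moreover have "- r2 * (lam * eta1 h) \<le> r1 * (lam * eta1 h)"
      using e lam_pos by (intro mult_right_mono) (auto simp: r2_eq)
    ultimately have 1: "0 \<le> r2 * \<beta>2 * U h + lam * r1 * eta1 h" by (simp add: algebra_simps)
    have "(1 - lam) powr \<beta>1 = (1 - lam) * eta2 h"
      using eta2_interior[OF h True] lam_less by (simp add: powr_mult_base)
    then have "r2 * (1 - lam) powr \<beta>1 + (1 - lam) * r1 * eta2 h = (1 - lam) * eta2 h"
      by (simp only: r2_eq) (simp add: algebra_simps)
    then have 2: "0 \<le> r2 * (1 - lam) powr \<beta>1 + (1 - lam) * r1 * eta2 h"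
      using e lam_less by simp
    show ?thesis using 1 2 by simp
  next
    case False
    then have X: "1 - lam \<le> X h" by simp
    have "\<beta>2 * U h + (1 - lam) powr \<beta>1 \<le> U h + (1 - lam) powr \<beta>1 / \<beta>1"
      using e par by (intro add_mono) (auto simp: field_simps)
    then have "\<beta>2 * U h + (1 - lam) powr \<beta>1 \<le> eta1 h" using eta1_corner[OF X] by simp
    then have "- r2 * (\<beta>2 * U h + (1 - lam) powr \<beta>1) \<le> - r2 * eta1 h"
      using r2_neg by (intro mult_left_mono) auto
    moreover have "- r2 * eta1 h \<le> r1 * eta1 h"
      using e by (intro mult_right_mono) (auto simp: r2_eq)
    ultimately have "0 \<le> (r2 * \<beta>2 * U h + lam * r1 * eta1 h)
        + (r2 * (1 - lam) powr \<beta>1 + (1 - lam) * r1 * eta1 h)"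
      by (simp add: algebra_simps)
    then show ?thesis
      unfolding eta2_corner[OF h X] distrib_left[symmetric] by simp
  qed
  then show ?thesis unfolding delta_def using r_pos r1_minus_r2 by (intro divide_nonneg_pos) auto
qed

text \<open>By \<open>U h \<le> eta1 h\<close> the bracket is of order \<open>eta1 h\<close>. The
  exponent \<open>1 - r1\<close> being negative, this bounds \<open>delta\<close> and makes the
  first summand vanish when \<open>eta1\<close> diverges, as for
  \<open>\<beta>1 < \<beta>2\<close>.\<close>

lemma eta1_term_bound: assumes h: "h > 0"
  shows "\<bar>eta1 h powr (- r1) * (r2 * \<beta>2 * U h + lam * r1 * eta1 h)\<bar> \<le> (r1 - r2) * eta1 h powr (1 - r1)"
proof -
  have e: "eta1 h > 0" "U h > 0" using eta1_pos U_pos h by auto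
  have "\<beta>2 * U h \<le> U h" using e par by (intro mult_left_le_one_le) auto
  then have "\<beta>2 * U h \<le> eta1 h" using U_le_eta1[OF h] by simp
  then have "- r2 * (\<beta>2 * U h) \<le> - r2 * eta1 h" using r2_neg by (intro mult_left_mono) auto
  moreover have "lam * (r1 * eta1 h) \<le> r1 * eta1 h" using e par by (intro mult_left_le_one_le) auto
  moreover have "0 \<le> - r2 * (\<beta>2 * U h)" "0 \<le> lam * (r1 * eta1 h)"
    using e par r2_neg by (intro mult_nonneg_nonneg; simp)+
  ultimately have "\<bar>r2 * \<beta>2 * U h + lam * r1 * eta1 h\<bar> \<le> (r1 - r2) * eta1 h"
    by (simp add: abs_if algebra_simps)
  then have "eta1 h powr (- r1) * \<bar>r2 * \<beta>2 * U h + lam * r1 * eta1 h\<bar>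
      \<le> eta1 h powr (- r1) * ((r1 - r2) * eta1 h)"
    by (intro mult_left_mono) auto
  also have "\<dots> = (r1 - r2) * eta1 h powr (1 - r1)"
    using powr_mult_base[of "eta1 h" "- r1"] e by (simp add: mult.commute)
  finally show ?thesis by (simp add: abs_mult)
qed

lemma delta_bounded: "\<exists>B. \<forall>h>0. \<bar>delta h\<bar> \<le> B"
proof -
  define c where "c = (1 - lam) powr \<beta>1"
  have c: "c > 0" using lam_less by (simp add: c_def)
  have "\<bar>delta h\<bar> \<le> ((r1 - r2) * c powr (1 - r1) + (r1 - r2) * c powr (1 - r1)) / (r * (r1 - r2))" if h: "h > 0" for h
  proof -
    have e: "c < eta1 h" "c < eta2 h" using eta1_gt eta2_gt h by (auto simp: c_def)
    have mono: "x powr (1 - r1) \<le> c powr (1 - r1)" if "c < x" for x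
      using that c r1_gt by (intro powr_mono2') auto
    let ?a = "eta1 h powr (- r1) * (r2 * \<beta>2 * U h + lam * r1 * eta1 h)"
    let ?b = "eta2 h powr (- r1) * (r2 * c + (1 - lam) * r1 * eta2 h)"
    have "(r1 - r2) * eta1 h powr (1 - r1) \<le> (r1 - r2) * c powr (1 - r1)"
      using r1_minus_r2 e mono by (intro mult_left_mono) auto
    then have 1: "\<bar>?a\<bar> \<le> (r1 - r2) * c powr (1 - r1)"
      using eta1_term_bound[OF h] by simp
    have "- r2 * c \<le> - r2 * eta2 h" using r2_neg e by (intro mult_left_mono) auto
    moreover have "(1 - lam) * (r1 * eta2 h) \<le> r1 * eta2 h" using e c par by (intro mult_left_le_one_le) auto
    moreover have "0 \<le> - r2 * c" "0 \<le> (1 - lam) * (r1 * eta2 h)"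
      using e c par r2_neg by (intro mult_nonneg_nonneg; simp)+
    ultimately have "\<bar>r2 * c + (1 - lam) * r1 * eta2 h\<bar> \<le> (r1 - r2) * eta2 h"
      by (simp add: abs_if algebra_simps)
    then have "\<bar>?b\<bar> \<le> eta2 h powr (- r1) * ((r1 - r2) * eta2 h)"
      by (simp add: abs_mult mult_left_mono)
    also have "\<dots> = (r1 - r2) * eta2 h powr (1 - r1)"
      using powr_mult_base[of "eta2 h" "- r1"] e c by (simp add: mult.commute)
    also have "\<dots> \<le> (r1 - r2) * c powr (1 - r1)"
      using r1_minus_r2 e mono by (intro mult_left_mono) auto
    finally have 2: "\<bar>?b\<bar> \<le> (r1 - r2) * c powr (1 - r1)" .
    have "\<bar>?a + ?b\<bar> \<le> (r1 - r2) * c powr (1 - r1) + (r1 - r2) * c powr (1 - r1)"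
      using 1 2 by linarith
    then have "\<bar>?a + ?b\<bar> / (r * (r1 - r2))
        \<le> ((r1 - r2) * c powr (1 - r1) + (r1 - r2) * c powr (1 - r1)) / (r * (r1 - r2))"
      using r_pos r1_minus_r2 by (intro divide_right_mono) auto
    moreover have "\<bar>delta h\<bar> = \<bar>?a + ?b\<bar> / (r * (r1 - r2))"
      using r_pos r1_minus_r2 by (simp add: delta_def c_def abs_mult)
    ultimately show ?thesis by simp
  qed
  then show ?thesis by blast
qed

text \<open>The constant in \<open>Y3 h powr (r1 - r2) = c0 * h powr ((r1 - r2) * (\<beta>1 -
  1))\<close>. The integrand of \<open>C6\<close> is thus
  \<open>deriv C5 s * Y3 s powr (r1 - r2)\<close>.\<close>

definition c0 :: real where "c0 = (1 - lam) powr ((r1 - r2) * \<beta>1)"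

lemma integrand_eq: assumes s: "s > 0"
  shows "C6_integrand r r1 r2 k lam \<beta>1 \<beta>2 s = c0 * (delta s * s powr (- ((1 - \<beta>1) * r1)))"
    and "C6_integrand r r1 r2 k lam \<beta>1 \<beta>2 s = c0 * D5 s * s powr ((r1 - r2) * (\<beta>1 - 1))"
proof -
  show *: "C6_integrand r r1 r2 k lam \<beta>1 \<beta>2 s = c0 * D5 s * s powr ((r1 - r2) * (\<beta>1 - 1))"
    unfolding C6_integrand_def c0_def using DERIV_imp_deriv[OF c5_deriv[OF s]] by simp
  have "s powr ((1 - \<beta>1) * (r1 - 1)) * s powr ((r1 - r2) * (\<beta>1 - 1)) = s powr (- ((1 - \<beta>1) * r1))"
    by (simp add: powr_add[symmetric] r2_eq algebra_simps)
  then show "C6_integrand r r1 r2 k lam \<beta>1 \<beta>2 s = c0 * (delta s * s powr (- ((1 - \<beta>1) * r1)))"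
    unfolding * D5_eq[OF s] by simp
qed

lemma kernel_cont: "continuous_on {0<..} (\<lambda>s. delta s * s powr (- ((1 - \<beta>1) * r1)))"
  by (intro continuous_intros delta_cont) auto

lemma kernel_integrable: assumes h: "h > 0" 
  shows "(\<lambda>s. delta s * s powr (- ((1 - \<beta>1) * r1))) integrable_on {h..}"
proof -
  obtain B where B: "\<And>h. h > 0 \<Longrightarrow> \<bar>delta h\<bar> \<le> B" using delta_bounded by blast
  show ?thesis
  proof (rule measurable_bounded_by_integrable_imp_integrable)
    show "(\<lambda>s. delta s * s powr (- ((1 - \<beta>1) * r1))) \<in> borel_measurable (lebesgue_on {h..})"
      using h by (intro continuous_imp_measurable_on_sets_lebesgue continuous_on_subset[OF kernel_cont]) auto
    show "(\<lambda>s. B * s powr (- ((1 - \<beta>1) * r1))) integrable_on {h..}"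
      using has_integral_powr_to_inf[of "- ((1 - \<beta>1) * r1)" h] exponent_gt h
      by (intro integrable_on_mult_right) (auto simp: integrable_on_def)
    show "norm (delta s * s powr (- ((1 - \<beta>1) * r1))) \<le> B * s powr (- ((1 - \<beta>1) * r1))" if "s \<in> {h..}" for s
      using B[of s] that h by (simp add: abs_mult mult_right_mono)
  qed auto
qed

lemma integrand_integrable: assumes h: "h > 0" 
  shows "C6_integrand r r1 r2 k lam \<beta>1 \<beta>2 integrable_on {h..}"
  using integrable_on_mult_right[OF kernel_integrable[OF h], of c0]
  by (rule integrable_eq) (use h in \<open>simp add: integrand_eq\<close>)

lemma c6_eq: assumes h: "h > 0" 
  shows "c6 h = c0 * integral {h..} (\<lambda>s. delta s * s powr (- ((1 - \<beta>1) * r1)))"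
proof -
  have "c6 h = integral {h..} (\<lambda>s. c0 * (delta s * s powr (- ((1 - \<beta>1) * r1))))"
    unfolding C6_def by (rule integral_cong) (use h in \<open>simp add: integrand_eq\<close>)
  then show ?thesis by simp
qed

lemma c6_deriv: assumes h: "h > 0"
  shows "(c6 has_real_derivative - (c0 * D5 h * h powr ((r1 - r2) * (\<beta>1 - 1)))) (at h)"
  unfolding C6_def[abs_def] integrand_eq(2)[OF h, symmetric]
proof (rule tail_integral_deriv[OF _ integrand_integrable h])
  show "continuous_on {0<..} (C6_integrand r r1 r2 k lam \<beta>1 \<beta>2)"
    by (subst continuous_on_cong[OF refl integrand_eq(1)])
      (auto intro!: continuous_on_mult_left kernel_cont)
qed

section \<open>Asymptotics of the coefficients\<close>

text \<open>The sign of \<open>\<beta>2 - \<beta>1\<close> governs \<open>U\<close>. If it is zero,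
  \<open>delta\<close> is constant. If negative, \<open>U\<close> tends to 0 and \<open>X\<close> to
  \<open>Ginv 0\<close>. If positive, \<open>U\<close> and \<open>eta1\<close> diverge, the first
  summand dies out, and the second is eventually constant because
  \<open>X h < 1 - lam\<close>.\<close>

lemma delta_limit: "\<exists>d\<ge>0. (delta \<longlongrightarrow> d) at_top"
proof -
  have "\<exists>d. (delta \<longlongrightarrow> d) at_top"
  proof -
    have pos: "\<forall>\<^sub>F h::real in at_top. h > 0" by (rule eventually_gt_at_top)
    consider "\<beta>2 = \<beta>1" | "\<beta>2 < \<beta>1" | "\<beta>1 < \<beta>2" by linarith
    then show ?thesis
    proof cases
      case 1
      have "delta h = delta 1" if "h > 0" for h
      proof -
        have "U h = U 1" unfolding U_def using that 1 by simp
        then show ?thesis by (simp only: delta_def eta2_def eta1_def m_def X_def)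
      qed
      then have "\<forall>\<^sub>F h in at_top. delta h = delta 1"
        by (rule eventually_mono[OF pos])
      then show ?thesis using tendsto_eventually by blast
    next
      case 2
      have "((\<lambda>h::real. h powr (\<beta>2 - \<beta>1)) \<longlongrightarrow> 0) at_top"
        using 2 by (intro tendsto_neg_powr filterlim_ident) auto
      then have U0: "(U \<longlongrightarrow> 0) at_top"
        unfolding U_def[abs_def] by (rule tendsto_mult_right_zero)
      obtain D where "(Ginv has_real_derivative D) (at 0)" using Ginv_deriv[of 0] by auto
      then have "isCont Ginv 0" by (rule DERIV_isCont)
      then have "(X \<longlongrightarrow> Ginv 0) at_top"
        unfolding X_def[abs_def] using U0 by (rule isCont_tendsto_compose)
      then have ml: "(m \<longlongrightarrow> min (Ginv 0) (1 - lam)) at_top"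
        unfolding m_def[abs_def] by (intro tendsto_intros)
      define m0 where "m0 = min (Ginv 0) (1 - lam)"
      have m0: "m0 > 0" using Ginv(1)[of 0] lam_less by (simp add: m0_def)
      define e where "e = (0 + m0 powr \<beta>1 / \<beta>1) / (lam + m0)"
      have e: "e > 0" using m0 par by (simp add: e_def)
      have e1: "(eta1 \<longlongrightarrow> e) at_top"
        unfolding eta1_def[abs_def] e_def using m0 par ml[folded m0_def]
        by (intro tendsto_intros U0) auto
      define e' where "e' = min e ((1 - lam) powr (\<beta>1 - 1))"
      have e': "e' > 0" using e lam_less by (simp add: e'_def)
      have e2: "(eta2 \<longlongrightarrow> e') at_top"
        unfolding eta2_def[abs_def] e'_def by (intro tendsto_intros e1)
      have "(delta \<longlongrightarrow> (e powr (- r1) * (r2 * \<beta>2 * 0 + lam * r1 * e)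
          + e' powr (- r1) * (r2 * (1 - lam) powr \<beta>1 + (1 - lam) * r1 * e')) / (r * (r1 - r2))) at_top"
        unfolding delta_def[abs_def] using e e' r_pos r1_minus_r2
        by (intro tendsto_intros e1 e2 U0) auto
      then show ?thesis by blast
    next
      case 3
      have c: "k * lam powr \<beta>2 / \<beta>2 > 0" using par by simp
      have Utop: "filterlim U at_top at_top"
        unfolding U_def[abs_def] using 3 c
        by (intro filterlim_tendsto_pos_mult_at_top[OF tendsto_const] real_powr_at_top) auto
      have "\<forall>\<^sub>F h in at_top. U h \<le> eta1 h" using pos by eventually_elim (rule U_le_eta1)
      with Utop have etop: "filterlim eta1 at_top at_top" by (rule filterlim_at_top_mono)
      have "((\<lambda>h. (r1 - r2) * eta1 h powr (1 - r1)) \<longlongrightarrow> 0) at_top"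
        using r1_gt by (intro tendsto_mult_right_zero tendsto_neg_powr etop) auto
      moreover have "\<forall>\<^sub>F h in at_top. norm (eta1 h powr (- r1) * (r2 * \<beta>2 * U h + lam * r1 * eta1 h))
            \<le> (r1 - r2) * eta1 h powr (1 - r1)"
        using pos by eventually_elim (use eta1_term_bound in auto)
      ultimately have 1: "((\<lambda>h. eta1 h powr (- r1) * (r2 * \<beta>2 * U h + lam * r1 * eta1 h)) \<longlongrightarrow> 0) at_top"
        by (rule Lim_null_comparison[rotated])
      define e where "e = (1 - lam) powr (\<beta>1 - 1)"
      have e: "e > 0" using lam_less by (simp add: e_def)
      have "\<forall>\<^sub>F h in at_top. G (1 - lam) < U h" using Utop by (simp add: filterlim_at_top_dense)
      then have "\<forall>\<^sub>F h in at_top. eta2 h = e"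
        using pos
      proof eventually_elim
        case (elim h)
        then have "X h < 1 - lam"
          using G_less_iff[OF X_pos[of h], of "1 - lam"] G_X[of h] lam_less by simp
        then show ?case using eta2_interior elim by (simp add: e_def)
      qed
      then have e2: "(eta2 \<longlongrightarrow> e) at_top" by (rule tendsto_eventually)
      have "(delta \<longlongrightarrow> (0
          + e powr (- r1) * (r2 * (1 - lam) powr \<beta>1 + (1 - lam) * r1 * e)) / (r * (r1 - r2))) at_top"
        unfolding delta_def[abs_def] using e r_pos r1_minus_r2
        by (intro tendsto_intros e2 1) auto
      then show ?thesis by blast
    qed
  qed
  then obtain d where d: "(delta \<longlongrightarrow> d) at_top" by blast
  have "\<forall>\<^sub>F h in at_top. 0 \<le> delta h"
    using eventually_gt_at_top[of 0] by eventually_elim (rule delta_nonneg)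
  with d have "d \<ge> 0" by (rule tendsto_lowerbound) simp
  with d show ?thesis by blast
qed

text \<open>Comparison with \<open>s powr (- a - 1)\<close>, whose tail integral is
  \<open>h powr (- a) / a\<close>: a deviation of \<open>delta\<close> from \<open>d\<close> below
  \<open>e * a / 2\<close> costs at most \<open>e / 2\<close> after scaling.\<close>

lemma tail_kernel_limit:
  assumes d: "(delta \<longlongrightarrow> d) at_top" and a: "a = (1 - \<beta>1) * r1 - 1"
  shows "((\<lambda>h. h powr a * integral {h..} (\<lambda>s. delta s * s powr (- ((1 - \<beta>1) * r1)))) \<longlongrightarrow> d / a) at_top"
proof (rule tendstoI)
  fix e :: real assume e: "e > 0"
  have a0: "a > 0" using exponent_gt a by simp
  have ex: "- ((1 - \<beta>1) * r1) = - a - 1" using a by simp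
  have "\<forall>\<^sub>F s in at_top. dist (delta s) d < e * a / 2" using d e a0 by (intro tendstoD) auto
  then obtain N where N: "\<And>s. s \<ge> N \<Longrightarrow> \<bar>delta s - d\<bar> < e * a / 2"
    by (auto simp: eventually_at_top_linorder dist_real_def)
  show "\<forall>\<^sub>F h in at_top. dist (h powr a * integral {h..} (\<lambda>s. delta s * s powr (- ((1 - \<beta>1) * r1)))) (d / a) < e"
    using eventually_ge_at_top[of N] eventually_gt_at_top[of 0]
  proof eventually_elim
    case (elim h)
    have pi: "((\<lambda>s. s powr (- a - 1)) has_integral h powr (- a) / a) {h..}"
      using has_integral_powr_to_inf[of "- a - 1" h] a0 elim by simp
    have int: "(\<lambda>s. delta s * s powr (- a - 1)) integrable_on {h..}"
      using kernel_integrable[of h] elim ex by simp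
    define I where "I = integral {h..} (\<lambda>s. delta s * s powr (- a - 1))"
    have i1: "((\<lambda>s. delta s * s powr (- a - 1) - d * s powr (- a - 1)) has_integral I - d * (h powr (- a) / a)) {h..}"
      unfolding I_def by (intro has_integral_diff has_integral_mult_right pi integrable_integral int)
    have i2: "((\<lambda>s. e * a / 2 * s powr (- a - 1)) has_integral e * a / 2 * (h powr (- a) / a)) {h..}"
      by (intro has_integral_mult_right pi)
    have i3: "norm (delta s * s powr (- a - 1) - d * s powr (- a - 1)) \<le> e * a / 2 * s powr (- a - 1)" if "s \<in> {h..}" for s
    proof -
      have "norm (delta s * s powr (- a - 1) - d * s powr (- a - 1)) = \<bar>delta s - d\<bar> * s powr (- a - 1)"
        by (simp add: left_diff_distrib[symmetric] abs_mult)
      also have "\<dots> \<le> e * a / 2 * s powr (- a - 1)"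
        using N[of s] that elim by (intro mult_right_mono) auto
      finally show ?thesis .
    qed
    have b: "\<bar>I - d * (h powr (- a) / a)\<bar> \<le> e * a / 2 * (h powr (- a) / a)"
      using integral_norm_bound_integral[OF has_integral_integrable[OF i1] has_integral_integrable[OF i2] i3]
      unfolding integral_unique[OF i1] integral_unique[OF i2] by simp
    have "h powr a * h powr (- a) = 1" using elim by (simp add: powr_add[symmetric])
    then have "h powr a * I - d / a = h powr a * (I - d * (h powr (- a) / a))"
      "h powr a * (e * a / 2 * (h powr (- a) / a)) = e / 2"
      using a0 by (simp_all add: field_simps)
    then have "\<bar>h powr a * I - d / a\<bar> \<le> e / 2"
      using mult_left_mono[OF b, of "h powr a"] by (simp add: abs_mult)
    then show ?case using e unfolding ex dist_real_def I_def by simp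
  qed
qed

text \<open>L'Hospital's rule in the form where only the denominator must diverge; the quotient of
  the derivatives is \<open>delta h / (n + 1)\<close>.\<close>

lemma c5_limit:
  assumes d: "(delta \<longlongrightarrow> d) at_top" and n: "n = (1 - \<beta>1) * (r1 - 1)"
  shows "((\<lambda>h. c5 h / h powr (n + 1)) \<longlongrightarrow> d / (n + 1)) at_top"
proof (rule lhospital_at_top_at_top)
  have n0: "n > 0" using n par by simp
  have pos: "\<forall>\<^sub>F h::real in at_top. h > 0" by (rule eventually_gt_at_top)
  show "filterlim (\<lambda>h. h powr (n + 1)) at_top at_top"
    using n0 by (intro real_powr_at_top) simp
  show "\<forall>\<^sub>F h in at_top. (n + 1) * h powr n \<noteq> 0"
    using pos by eventually_elim (use n0 in auto)
  show "\<forall>\<^sub>F h in at_top. (c5 has_real_derivative D5 h) (at h)"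
    using pos by eventually_elim (rule c5_deriv)
  show "\<forall>\<^sub>F h in at_top. ((\<lambda>h. h powr (n + 1)) has_real_derivative (n + 1) * h powr n) (at h)"
    using pos by eventually_elim (auto intro!: derivative_eq_intros)
  have "\<forall>\<^sub>F h in at_top. delta h / (n + 1) = D5 h / ((n + 1) * h powr n)"
    using pos by eventually_elim (simp add: D5_eq n)
  moreover have "((\<lambda>h. delta h / (n + 1)) \<longlongrightarrow> d / (n + 1)) at_top"
    using n0 by (intro tendsto_intros d) auto
  ultimately show "((\<lambda>h. D5 h / ((n + 1) * h powr n)) \<longlongrightarrow> d / (n + 1)) at_top"
    by (rule Lim_transform_eventually[rotated])
qed

section \<open>Branches and smooth fit\<close>

text \<open>Chosen so that \<open>P0 * y powr \<gamma>\<close> is a particular solution for the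
  right-hand side \<open>y powr \<gamma> / \<gamma>\<close>.\<close>

definition P0 :: real where "P0 = 2 / (\<kappa>\<^sup>2 * \<gamma> * (\<gamma> - r1) * (\<gamma> - r2))"

text \<open>
  Each of the three branches of the solution has the form \<open>branch a b c e l\<close>, with \<open>c = 1\<close> in the
  middle branch and \<open>c = 0\<close> otherwise, and solves the equation whose right-hand side comes from \<open>branch_V c e l\<close>.
\<close>

definition branch :: "real \<Rightarrow> real \<Rightarrow> real \<Rightarrow> real \<Rightarrow> real \<Rightarrow> real \<Rightarrow> real" where
  "branch a b c e l y = a * y powr r1 + b * y powr r2 + c * P0 * y powr \<gamma> + e + l * y"

definition branch' :: "real \<Rightarrow> real \<Rightarrow> real \<Rightarrow> real \<Rightarrow> real \<Rightarrow> real" where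
  "branch' a b c l y = r1 * a * y powr (r1 - 1) + r2 * b * y powr (r2 - 1) + c * P0 * \<gamma> * y powr (\<gamma> - 1) + l"

definition branch_V :: "real \<Rightarrow> real \<Rightarrow> real \<Rightarrow> real \<Rightarrow> real" where
  "branch_V c e l y = r * e + r * l * y - c / \<gamma> * y powr \<gamma>"

text \<open>The second derivative as dictated by the equation. The equation then holds by
  construction, and second derivatives match at a curve as soon as the values of the branches and of
  \<open>V\<close> do.\<close>

definition branch'' :: "real \<Rightarrow> real \<Rightarrow> real \<Rightarrow> real \<Rightarrow> real \<Rightarrow> real \<Rightarrow> real" where
  "branch'' a b c e l y = 2 / (\<kappa>\<^sup>2 * y\<^sup>2) * (r * branch a b c e l y - branch_V c e l y)"

lemma branch_deriv: "y > 0 \<Longrightarrow> (branch a b c e l has_real_derivative branch' a b c l y) (at y)"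
  unfolding branch_def[abs_def] branch'_def by (auto intro!: derivative_eq_intros)

lemma branch'_deriv: assumes y: "y > 0"
  shows "(branch' a b c l has_real_derivative branch'' a b c e l y) (at y)"
proof -
  have D: "((branch' a b c l) has_real_derivative
     r1 * a * ((r1 - 1) * y powr (r1 - 1 - 1)) + r2 * b * ((r2 - 1) * y powr (r2 - 1 - 1))
       + c * P0 * \<gamma> * ((\<gamma> - 1) * y powr (\<gamma> - 1 - 1))) (at y)"
    unfolding branch'_def[abs_def] using y by (auto intro!: derivative_eq_intros)
  have p: "y powr (x - 1 - 1) = y powr x / y\<^sup>2" for x
    using y by (simp add: powr_diff power2_eq_square)
  have q: "r1 * (r1 - 1) = 2 * r / \<kappa>\<^sup>2" "r2 * (r2 - 1) = 2 * r / \<kappa>\<^sup>2"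
    using r1_r2 by (auto simp: r2_eq algebra_simps)
  have "\<gamma> * (\<gamma> - 1) - 2 * r / \<kappa>\<^sup>2 = (\<gamma> - r1) * (\<gamma> - r2)"
    using q(1) by (simp add: r2_eq algebra_simps)
  moreover have "2 / (p * x * w) * (x * w) = 2 / p" if "x \<noteq> 0" "w \<noteq> 0" for p x w :: real
    using that by simp
  ultimately have P: "P0 * (\<gamma> * (\<gamma> - 1) - 2 * r / \<kappa>\<^sup>2) = 2 / (\<kappa>\<^sup>2 * \<gamma>)"
    using gamma_props by (simp only: P0_def not_False_eq_True)
  have "r1 * a * ((r1 - 1) * y powr (r1 - 1 - 1)) + r2 * b * ((r2 - 1) * y powr (r2 - 1 - 1))
       + c * P0 * \<gamma> * ((\<gamma> - 1) * y powr (\<gamma> - 1 - 1))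
     = (a * (r1 * (r1 - 1)) * y powr r1 + b * (r2 * (r2 - 1)) * y powr r2
         + c * (P0 * (\<gamma> * (\<gamma> - 1) - 2 * r / \<kappa>\<^sup>2) + P0 * (2 * r / \<kappa>\<^sup>2)) * y powr \<gamma>) / y\<^sup>2"
    unfolding p by (simp add: add_divide_distrib diff_divide_distrib algebra_simps)
  also have "\<dots> = branch'' a b c e l y"
    unfolding P q branch''_def branch_def branch_V_def using y kappa_nz gamma_props
    by (simp add: field_simps)
  finally show ?thesis using D by simp
qed

text \<open>The coefficients \<open>a\<close> and \<open>b\<close> solve the 2 by 2 linear system
  that makes a branch vanish to first order at \<open>y\<close>. The increments in \<open>C2\<close>
  to \<open>C5\<close> are such solutions, so smooth fit follows by applying this to the difference
  of adjacent branches.\<close>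

lemma branch_vanish:
  assumes y: "y > 0"
    and a: "a = y powr (- r1) / (r * (r1 - r2)) * (r2 * E + c * (r1 * r2 / (\<gamma> * (\<gamma> - r1))) * y powr \<gamma> + L * r1 * y)"
    and b: "b = - (y powr (- r2) / (r * (r1 - r2)) * (r1 * E + c * (r1 * r2 / (\<gamma> * (\<gamma> - r2))) * y powr \<gamma> + L * r2 * y))"
  shows "branch a b c (E / r) (- (L / r)) y = 0" "branch' a b c (- (L / r)) y = 0"
proof -
  define Q where "Q = y powr \<gamma>"
  define d where "d = r * (r1 - r2)"
  define q1 where "q1 = r1 * r2 / (\<gamma> * (\<gamma> - r1))"
  define q2 where "q2 = r1 * r2 / (\<gamma> * (\<gamma> - r2))"
  have d: "d \<noteq> 0" using r_pos r1_minus_r2 by (simp add: d_def)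
  have pw: "y powr (- x) * y powr x = 1" for x using y by (simp add: powr_add[symmetric])
  have A: "a * y powr r1 = (r2 * E + c * q1 * Q + L * r1 * y) / d"
  proof -
    have "a * y powr r1 = (y powr (- r1) * y powr r1) * (r2 * E + c * q1 * Q + L * r1 * y) / d"
      unfolding a d_def q1_def Q_def by simp
    then show ?thesis unfolding pw by simp
  qed
  have B: "b * y powr r2 = - ((r1 * E + c * q2 * Q + L * r2 * y) / d)"
  proof -
    have "b * y powr r2 = - ((y powr (- r2) * y powr r2) * (r1 * E + c * q2 * Q + L * r2 * y) / d)"
      unfolding b d_def q2_def Q_def by simp
    then show ?thesis unfolding pw by simp
  qed
  have k2: "2 / \<kappa>\<^sup>2 = - (r1 * r2) / r" using r1_r2 r_pos by (simp add: field_simps)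
  have "P0 = (2 / \<kappa>\<^sup>2) / (\<gamma> * (\<gamma> - r1) * (\<gamma> - r2))" by (simp add: P0_def)
  then have P: "P0 = - (r1 * r2) / (r * (\<gamma> * (\<gamma> - r1) * (\<gamma> - r2)))"
    unfolding k2 by simp
  have q: "q1 - q2 = - d * P0" "r1 * q1 - r2 * q2 = - d * P0 * \<gamma>"
    unfolding q1_def q2_def P d_def using gamma_props r_pos
    by (simp_all add: divide_simps) (simp_all add: algebra_simps)
  have s: "r1 + r2 = 1" by (simp add: r2_eq)
  have "d * branch a b c (E / r) (- (L / r)) y
     = (r2 * E + c * q1 * Q + L * r1 * y) - (r1 * E + c * q2 * Q + L * r2 * y) + c * (d * P0) * Q + (d / r) * (E - L * y)"
  proof -
    have "d * (N1 / d + - (N2 / d) + c * P0 * Q + E / r + - (L / r) * y)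
        = N1 - N2 + c * (d * P0) * Q + (d / r) * (E - L * y)" for N1 N2
      using d by (simp add: algebra_simps diff_divide_distrib)
    then show ?thesis unfolding branch_def A B Q_def[symmetric] .
  qed
  also have "d * P0 = q2 - q1" using q by simp
  also have "d / r = r1 - r2" using r_pos by (simp add: d_def)
  finally show "branch a b c (E / r) (- (L / r)) y = 0"
    using d by (simp add: algebra_simps)
  have yp: "y * y powr (x - 1) = y powr x" for x using y by (simp add: powr_mult_base)
  have "d * (y * branch' a b c (- (L / r)) y)
    = d * (r1 * (a * (y * y powr (r1 - 1))) + r2 * (b * (y * y powr (r2 - 1))) + c * P0 * \<gamma> * (y * y powr (\<gamma> - 1)) - L / r * y)"
    by (simp add: branch'_def algebra_simps)
  also have "\<dots> = r1 * (r2 * E + c * q1 * Q + L * r1 * y) - r2 * (r1 * E + c * q2 * Q + L * r2 * y)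
      + c * (d * P0 * \<gamma>) * Q - (d / r) * (L * y)"
  proof -
    have "d * (r1 * (N1 / d) + r2 * (- (N2 / d)) + c * P0 * \<gamma> * Q - L / r * y)
        = r1 * N1 - r2 * N2 + c * (d * P0 * \<gamma>) * Q - (d / r) * (L * y)" for N1 N2
      using d by (simp add: algebra_simps)
    then show ?thesis unfolding yp A B Q_def[symmetric] .
  qed
  also have "d * P0 * \<gamma> = r2 * q2 - r1 * q1" using q by simp
  \<comment> \<open>The factor \<open>r1 + r2 = 1\<close> is inserted because the linear terms of
    the two numerators combine to \<open>(r1 * r1 - r2 * r2) * L * y\<close>.\<close>
  also have "d / r = (r1 + r2) * (r1 - r2)" using r_pos s by (simp add: d_def)
  finally have "d * (y * branch' a b c (- (L / r)) y) = 0"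
    by (simp add: algebra_simps)
  then show "branch' a b c (- (L / r)) y = 0" using d y by simp
qed

lemma branch_diff: "branch a b c e l y - branch a' b' c' e' l' y = branch (a - a') (b - b') (c - c') (e - e') (l - l') y"
  and branch'_diff: "branch' a b c l y - branch' a' b' c' l' y = branch' (a - a') (b - b') (c - c') (l - l') y"
  by (simp_all add: branch_def branch'_def algebra_simps)

text \<open>The suffixes \<open>R\<close>, \<open>M\<close> and \<open>T\<close> refer to the
  regions above \<open>Y1\<close>, between the curves, and below \<open>Y2\<close>.
  \<open>eR\<close> and \<open>eT\<close> are the additive constants of the outer branches;
  \<open>eR h\<close> is also the limit prescribed in (c).\<close>

definition eR :: "real \<Rightarrow> real" where "eR h = - (k / \<beta>2 * (lam * h) powr \<beta>2) / r"
definition eT :: "real \<Rightarrow> real" where "eT h = (1 / \<beta>1 * ((1 - lam) * h) powr \<beta>1) / r"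

abbreviation "solR h \<equiv> branch 0 (c2 h) 0 (eR h) 0"
abbreviation "solM h \<equiv> branch (c3 h) (c4 h) 1 0 (- (lam * h / r))"
abbreviation "solT h \<equiv> branch (c5 h) (c6 h) 0 (eT h) (- (h / r))"
abbreviation "solR' h \<equiv> branch' 0 (c2 h) 0 0"
abbreviation "solM' h \<equiv> branch' (c3 h) (c4 h) 1 (- (lam * h / r))"
abbreviation "solT' h \<equiv> branch' (c5 h) (c6 h) 0 (- (h / r))"
abbreviation "solR'' h \<equiv> branch'' 0 (c2 h) 0 (eR h) 0"
abbreviation "solM'' h \<equiv> branch'' (c3 h) (c4 h) 1 0 (- (lam * h / r))"
abbreviation "solT'' h \<equiv> branch'' (c5 h) (c6 h) 0 (eT h) (- (h / r))"

lemma vsol_eq: "v\<^sub>0 y h = piecewise3 (y1 h) (y2 h) (solR h) (solM h) (solT h) y"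
  by (simp add: vsol_def piecewise3_def branch_def eR_def eT_def P0_def)

lemma V_eq: "V y h = piecewise3 (y1 h) (y2 h) (branch_V 0 (eR h) 0) (branch_V 1 0 (- (lam * h / r))) (branch_V 0 (eT h) (- (h / r))) y"
proof -
  have "(\<beta>1 - 1) / \<beta>1 = 1 / \<gamma>" by (simp add: gam1_def)
  moreover have "\<beta>1 / (\<beta>1 - 1) = \<gamma>" by (simp add: gam1_def)
  ultimately show ?thesis
    unfolding Vfun_def piecewise3_def branch_V_def eR_def eT_def using r_pos
    by (auto simp: algebra_simps)
qed

section \<open>Smooth fit across the curves\<close>

lemma match_y1: assumes h: "h > 0"
  shows "solR h (y1 h) = solM h (y1 h)" "solR' h (y1 h) = solM' h (y1 h)"
proof -
  have e: "0 - eR h = (k / \<beta>2 * (lam * h) powr \<beta>2) / r" "- (lam * h / r) - 0 = - (lam * h / r)"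
    by (simp_all add: eR_def)
  have a: "c3 h - 0 = y1 h powr (- r1) / (r * (r1 - r2)) * (r2 * (k / \<beta>2 * (lam * h) powr \<beta>2)
     + (1 - 0) * (r1 * r2 / (\<gamma> * (\<gamma> - r1))) * y1 h powr \<gamma> + lam * h * r1 * y1 h)"
    by (simp add: c3_eq PA_def)
  have b: "c4 h - c2 h = - (y1 h powr (- r2) / (r * (r1 - r2)) * (r1 * (k / \<beta>2 * (lam * h) powr \<beta>2)
     + (1 - 0) * (r1 * r2 / (\<gamma> * (\<gamma> - r2))) * y1 h powr \<gamma> + lam * h * r2 * y1 h))"
    by (simp add: C2_def algebra_simps)
  show "solR h (y1 h) = solM h (y1 h)" "solR' h (y1 h) = solM' h (y1 h)"
    using branch_vanish[OF y_pos(1)[OF h] a b] branch_diff[of "c3 h" "c4 h" 1 0 "- (lam * h / r)" "y1 h" 0 "c2 h" 0 "eR h" 0]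
      branch'_diff[of "c3 h" "c4 h" 1 "- (lam * h / r)" "y1 h" 0 "c2 h" 0 0]
    unfolding e by simp_all
qed

lemma match_y2: assumes h: "h > 0"
  shows "solM h (y2 h) = solT h (y2 h)" "solM' h (y2 h) = solT' h (y2 h)"
proof -
  have e: "eT h - 0 = (1 / \<beta>1 * ((1 - lam) * h) powr \<beta>1) / r" "- (h / r) - - (lam * h / r) = - ((1 - lam) * h / r)"
    by (simp_all add: eT_def diff_divide_distrib left_diff_distrib)
  have a: "c5 h - c3 h = y2 h powr (- r1) / (r * (r1 - r2)) * (r2 * (1 / \<beta>1 * ((1 - lam) * h) powr \<beta>1)
     + (0 - 1) * (r1 * r2 / (\<gamma> * (\<gamma> - r1))) * y2 h powr \<gamma> + (1 - lam) * h * r1 * y2 h)"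
    by (simp add: c3_eq c5_eq PB_def)
  have b: "c6 h - c4 h = - (y2 h powr (- r2) / (r * (r1 - r2)) * (r1 * (1 / \<beta>1 * ((1 - lam) * h) powr \<beta>1)
     + (0 - 1) * (r1 * r2 / (\<gamma> * (\<gamma> - r2))) * y2 h powr \<gamma> + (1 - lam) * h * r2 * y2 h))"
    by (simp add: C4_def algebra_simps)
  show "solM h (y2 h) = solT h (y2 h)" "solM' h (y2 h) = solT' h (y2 h)"
    using branch_vanish[OF y_pos(2)[OF h] a b]
      branch_diff[of "c5 h" "c6 h" 0 "eT h" "- (h / r)" "y2 h" "c3 h" "c4 h" 1 0 "- (lam * h / r)"]
      branch'_diff[of "c5 h" "c6 h" 0 "- (h / r)" "y2 h" "c3 h" "c4 h" 1 "- (lam * h / r)"]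
    unfolding e by simp_all
qed

lemma V_match:
  assumes h: "h > 0"
  shows "y2 h < y1 h \<Longrightarrow> branch_V 0 (eR h) 0 (y1 h) = branch_V 1 0 (- (lam * h / r)) (y1 h)
           \<and> branch_V 1 0 (- (lam * h / r)) (y2 h) = branch_V 0 (eT h) (- (h / r)) (y2 h)"
    and "y2 h = y1 h \<Longrightarrow> branch_V 0 (eR h) 0 (y1 h) = branch_V 0 (eT h) (- (h / r)) (y1 h)"
proof -
  have int: "X h \<le> 1 - lam" if "y2 h < y1 h" using that y_corner[OF h] by force
  have corner: "1 - lam \<le> X h" if "y2 h = y1 h"
    using that eta2_interior[OF h] h by (force simp: y1_eq y2_eq)
  show "branch_V 0 (eR h) 0 (y1 h) = branch_V 1 0 (- (lam * h / r)) (y1 h)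
           \<and> branch_V 1 0 (- (lam * h / r)) (y2 h) = branch_V 0 (eT h) (- (h / r)) (y2 h)" if "y2 h < y1 h"
    using y_interior[OF h int[OF that]] V_jump_ya[OF h] V_jump_yb[OF h] r_pos
    by (simp add: branch_V_def eR_def eT_def algebra_simps)
  show "branch_V 0 (eR h) 0 (y1 h) = branch_V 0 (eT h) (- (h / r)) (y1 h)" if "y2 h = y1 h"
    using y_corner[OF h corner[OF that]] V_jump_ym[OF h] r_pos
    by (simp add: branch_V_def eR_def eT_def algebra_simps)
qed

section \<open>The equation on the whole half-line\<close>

definition vy :: "real \<Rightarrow> real \<Rightarrow> real" where
  "vy y h = piecewise3 (y1 h) (y2 h) (solR' h) (solM' h) (solT' h) y"

definition vyy :: "real \<Rightarrow> real \<Rightarrow> real" where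
  "vyy y h = piecewise3 (y1 h) (y2 h) (solR'' h) (solM'' h) (solT'' h) y"

lemma vsol_deriv: assumes h: "h > 0" and y: "y > 0"
  shows "((\<lambda>y. v\<^sub>0 y h) has_real_derivative vy y h) (at y)"
  unfolding vsol_eq vy_def
  by (rule piecewise3_deriv) (use y2_le_y1 match_y1[OF h] match_y2[OF h] branch_deriv[OF y] in auto)

text \<open>\<open>branch''\<close> depends only on the values of the branch and of
  \<open>branch_V\<close>, so smooth fit and \<open>V_match\<close> give equal second derivatives at
  the curves.\<close>

lemma vy_deriv: assumes h: "h > 0" and y: "y > 0"
  shows "((\<lambda>y. vy y h) has_real_derivative vyy y h) (at y)"
  unfolding vyy_def vy_def
proof (rule piecewise3_deriv)
  show "y2 h = y1 h \<Longrightarrow> solR' h (y1 h) = solT' h (y1 h) \<and> solR'' h (y1 h) = solT'' h (y1 h)"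
    using match_y1[OF h] match_y2[OF h] V_match(2)[OF h] by (simp add: branch''_def)
  show "y2 h < y1 h \<Longrightarrow> solR' h (y1 h) = solM' h (y1 h) \<and> solR'' h (y1 h) = solM'' h (y1 h)
      \<and> solM' h (y2 h) = solT' h (y2 h) \<and> solM'' h (y2 h) = solT'' h (y2 h)"
    using match_y1[OF h] match_y2[OF h] V_match(1)[OF h] by (simp add: branch''_def)
qed (intro y2_le_y1 branch'_deriv[OF y])+

lemma vsol_ode: assumes y: "y > 0"
  shows "\<kappa>\<^sup>2 / 2 * y\<^sup>2 * vyy y h - r * v\<^sub>0 y h = - V y h"
proof -
  have "\<kappa>\<^sup>2 / 2 * y\<^sup>2 * branch'' a b c e l y - r * branch a b c e l y = - branch_V c e l y" for a b c e l
  proof -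
    have "\<kappa>\<^sup>2 / 2 * y\<^sup>2 * (2 / (\<kappa>\<^sup>2 * y\<^sup>2) * D) = D" for D using y kappa_nz by simp
    then show ?thesis unfolding branch''_def by (simp only:)
  qed
  then show ?thesis
    unfolding vyy_def V_eq vsol_eq piecewise3_def by simp
qed

section \<open>Existence\<close>

lemma c5_cont: "continuous_on {0<..} c5" and c6_cont: "continuous_on {0<..} c6"
  by (auto intro!: continuous_at_imp_continuous_on DERIV_isCont[OF c5_deriv] DERIV_isCont[OF c6_deriv])

lemma c3_cont: "continuous_on {0<..} c3" and c4_cont: "continuous_on {0<..} c4"
  and c2_cont: "continuous_on {0<..} c2"
proof -
  have nz: "r * (r1 - r2) \<noteq> 0" "\<beta>1 \<noteq> 0" "\<beta>2 \<noteq> 0" using par r1_minus_r2 by auto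
  have ypos: "\<And>h. h > 0 \<Longrightarrow> y1 h \<noteq> 0" "\<And>h. h > 0 \<Longrightarrow> y2 h \<noteq> 0" using y_pos by (metis less_irrefl)+
  show "continuous_on {0<..} c3"
    unfolding C3_def[abs_def] using ypos nz par by (intro continuous_intros y1_cont) auto
  show c4: "continuous_on {0<..} c4"
    unfolding C4_def[abs_def] using ypos nz par by (intro continuous_intros y2_cont c6_cont) auto
  show "continuous_on {0<..} c2"
    unfolding C2_def[abs_def] using ypos nz par by (intro continuous_intros y1_cont c4) auto
qed

lemma branch_cont:
  assumes "continuous_on S a" "continuous_on S b" "continuous_on S e" "continuous_on S l" "continuous_on S f"
    and "\<And>z. z \<in> S \<Longrightarrow> f z > 0"
  shows "continuous_on S (\<lambda>z. branch (a z) (b z) c (e z) (l z) (f z))"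
proof -
  have "\<And>z. z \<in> S \<Longrightarrow> f z \<noteq> 0" using assms(6) by (metis less_irrefl)
  then show ?thesis
    unfolding branch_def by (intro continuous_intros assms(1-5)) auto
qed

lemma vsol_sum: assumes h: "h > 0"
  shows "v\<^sub>0 y h = solR h (max y (y1 h)) + solM h (max (y2 h) (min y (y1 h))) + solT h (min y (y2 h))
           - solM h (y1 h) - solT h (y2 h)"
  unfolding vsol_eq using match_y1(1)[OF h] match_y2(1)[OF h] by (intro piecewise3_eq_sum y2_le_y1) auto

lemma dom_pos: "(y, h) \<in> dom_yh lam \<beta>1 \<Longrightarrow> 0 < h \<and> 0 < y"
  using y_pos(3) by (force simp: dom_yh_def)

lemma vsol_cont: "continuous_on (dom_yh lam \<beta>1) (\<lambda>(y, h). v\<^sub>0 y h)"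
proof -
  let ?D = "dom_yh lam \<beta>1"
  have D: "0 < snd z \<and> 0 < fst z" if "z \<in> ?D" for z using dom_pos[of "fst z" "snd z"] that by simp
  have sub: "snd ` ?D \<subseteq> {0<..}" using D by auto
  have snd_cont: "continuous_on ?D (\<lambda>z. f (snd z))" if "continuous_on {0<..} f" for f :: "real \<Rightarrow> real"
    using sub by (rule continuous_on_compose2[OF that continuous_on_snd[OF continuous_on_id]])
  have eR: "continuous_on {0<..} eR" and eT: "continuous_on {0<..} eT"
    unfolding eR_def[abs_def] eT_def[abs_def] using par by (auto intro!: continuous_intros)
  have ypos: "\<And>h. h > 0 \<Longrightarrow> y1 h > 0" "\<And>h. h > 0 \<Longrightarrow> y2 h > 0" using y_pos by auto
  note rules = continuous_intros snd_cont branch_cont eR eT c2_cont c3_cont c4_cont c5_cont c6_cont y1_cont y2_cont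
  have r: "r \<noteq> 0" using r_pos by simp
  have R: "continuous_on ?D (\<lambda>z. solR (snd z) (max (fst z) (y1 (snd z))))"
    by (rule branch_cont, (intro rules; fail)+) (use D ypos in \<open>auto simp: max_def\<close>)
  have M: "continuous_on ?D (\<lambda>z. solM (snd z) (max (y2 (snd z)) (min (fst z) (y1 (snd z)))))"
    by (rule branch_cont, (intro rules r; fail)+, intro rules, use r in blast, intro rules) 
      (use D ypos in \<open>auto simp: max_def\<close>)
  have T: "continuous_on ?D (\<lambda>z. solT (snd z) (min (fst z) (y2 (snd z))))"
    by (rule branch_cont, (intro rules; fail)+, intro rules, use r in blast, intro rules)
      (use D ypos in \<open>auto simp: min_def\<close>)
  have M1: "continuous_on {0<..} (\<lambda>h. solM h (y1 h))" and T2: "continuous_on {0<..} (\<lambda>h. solT h (y2 h))"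
    by (rule branch_cont; (intro rules)?; use r ypos in auto)+
  have "continuous_on ?D (\<lambda>z. solR (snd z) (max (fst z) (y1 (snd z)))
      + solM (snd z) (max (y2 (snd z)) (min (fst z) (y1 (snd z)))) + solT (snd z) (min (fst z) (y2 (snd z)))
      - solM (snd z) (y1 (snd z)) - solT (snd z) (y2 (snd z)))"
    by (intro continuous_on_add continuous_on_diff R M T snd_cont[OF M1] snd_cont[OF T2])
  then show ?thesis
    by (rule continuous_on_eq) (auto simp: vsol_sum dest: dom_pos)
qed

section \<open>Behaviour along \<open>Y3\<close> and as \<open>y\<close> tends to infinity\<close>

lemma vsol_third: "y < y2 h \<Longrightarrow> v\<^sub>0 y h = solT h y" "y < y2 h \<Longrightarrow> vy y h = solT' h y"
  using y2_le_y1[of h] by (auto simp: vsol_eq vy_def piecewise3_def)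

lemma y3_powr: "h > 0 \<Longrightarrow> y3 h powr x = h powr ((\<beta>1 - 1) * x) * (1 - lam) powr (\<beta>1 * x)"
  using lam_less by (simp add: y3_eq powr_mult powr_powr)

text \<open>Along \<open>Y3\<close> the terms of \<open>vy\<close> are at most of order
  \<open>h\<close>, and those of \<open>v\<^sub>0 - y * vy\<close> at most of order
  \<open>h powr \<beta>1\<close>. The forcing terms contribute \<open>- 1 / r\<close> and a positive
  constant, so weak inequalities for the homogeneous parts give strict signs.\<close>

lemma boundary_limits:
  "\<exists>L<0. ((\<lambda>h. vy (y3 h) h / h) \<longlongrightarrow> L) at_top"
  "\<exists>L>0. ((\<lambda>h. (v\<^sub>0 (y3 h) h - y3 h * vy (y3 h) h) / h powr \<beta>1) \<longlongrightarrow> L) at_top"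
proof -
  obtain d where d: "d \<ge> 0" "(delta \<longlongrightarrow> d) at_top" using delta_limit by blast
  define n where "n = (1 - \<beta>1) * (r1 - 1)"
  define a where "a = (1 - \<beta>1) * r1 - 1"
  have a0: "a > 0" using exponent_gt by (simp add: a_def)
  have n_eq: "n = a + \<beta>1" by (simp add: n_def a_def algebra_simps)
  have n0: "n > 0" using a0 b1_pos by (simp add: n_eq)
  have l5: "((\<lambda>h. c5 h / h powr (n + 1)) \<longlongrightarrow> d / (n + 1)) at_top"
    by (rule c5_limit[OF d(2) n_def])
  have pos: "\<forall>\<^sub>F h::real in at_top. h > 0" by (rule eventually_gt_at_top)
  have "((\<lambda>h. c0 * (h powr a * integral {h..} (\<lambda>s. delta s * s powr (- ((1 - \<beta>1) * r1))))) \<longlongrightarrow> c0 * (d / a)) at_top"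
    by (intro tendsto_mult_left tail_kernel_limit[OF d(2) a_def])
  moreover have "\<forall>\<^sub>F h in at_top. c0 * (h powr a * integral {h..} (\<lambda>s. delta s * s powr (- ((1 - \<beta>1) * r1)))) = h powr a * c6 h"
    using pos by eventually_elim (simp add: c6_eq)
  ultimately have l6: "((\<lambda>h. h powr a * c6 h) \<longlongrightarrow> c0 * (d / a)) at_top"
    by (rule Lim_transform_eventually)

  define q where "q = (1 - lam) powr (\<beta>1 * (r1 - 1))"
  define q2 where "q2 = (1 - lam) powr (\<beta>1 * (r2 - 1))"
  have q: "q > 0" using lam_less by (simp add: q_def)
  \<comment> \<open>The constant \<open>c0\<close> makes the contributions of \<open>C5\<close> and
    \<open>C6\<close> carry the same factor \<open>d * q\<close>, so they can be compared.\<close>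
  have c0q2: "c0 * q2 = q"
    unfolding c0_def q2_def q_def by (simp add: powr_add[symmetric] r2_eq algebra_simps)
  let ?L = "r1 * (d / (n + 1)) * q + r2 * (c0 * (d / a)) * q2 - 1 / r"
  have "\<forall>\<^sub>F h in at_top. r1 * (c5 h / h powr (n + 1)) * q + r2 * (h powr a * c6 h) * q2 - 1 / r = vy (y3 h) h / h"
    using pos
  proof eventually_elim
    case (elim h)
    have e1: "(\<beta>1 - 1) * (r1 - 1) = - n" by (simp add: n_def algebra_simps)
    have e2: "(\<beta>1 - 1) * (r2 - 1) = a + 1" by (simp add: a_def r2_eq algebra_simps)
    have p1: "y3 h powr (r1 - 1) = h powr (- n) * q" "y3 h powr (r2 - 1) = h powr (a + 1) * q2"
      unfolding y3_powr[OF elim] e1 e2 q_def q2_def by auto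
    have p2: "h powr (- n) = h / h powr (n + 1)" "h powr (a + 1) = h * h powr a"
      using elim by (simp_all add: powr_add powr_minus field_simps)
    show ?case
      unfolding vsol_third(2)[OF y3_less_y2[OF elim]] branch'_def p1 p2 using elim
      by (simp add: field_simps)
  qed
  moreover have "((\<lambda>h. r1 * (c5 h / h powr (n + 1)) * q + r2 * (h powr a * c6 h) * q2 - 1 / r) \<longlongrightarrow> ?L) at_top"
    by (intro tendsto_intros l5 l6)
  ultimately have lim: "((\<lambda>h. vy (y3 h) h / h) \<longlongrightarrow> ?L) at_top"
    by (rule Lim_transform_eventually[rotated])
  \<comment> \<open>The difference of the two sides of the next inequality.\<close>
  have "0 \<le> \<beta>1 * (2 * r1 - 1)" using par by simp
  then have "r1 * a \<le> (r1 - 1) * (n + 1)" unfolding n_eq a_def by (simp add: algebra_simps)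
  then have "r1 / (n + 1) \<le> (r1 - 1) / a" using a0 n0 by (simp add: field_simps)
  then have "d * q * (r1 / (n + 1) - (r1 - 1) / a) \<le> 0"
    using d q by (intro mult_nonneg_nonpos) auto
  moreover have "?L = d * q * (r1 / (n + 1) - (r1 - 1) / a) - 1 / r"
    unfolding c0q2[symmetric] by (simp add: r2_eq algebra_simps diff_divide_distrib)
  moreover have "1 / r > 0" using r_pos by simp
  ultimately have "?L < 0" by linarith
  with lim show "\<exists>L<0. ((\<lambda>h. vy (y3 h) h / h) \<longlongrightarrow> L) at_top" by blast

  define s1 where "s1 = (1 - lam) powr (\<beta>1 * r1)"
  define s2 where "s2 = (1 - lam) powr (\<beta>1 * r2)"
  have s: "s1 > 0" using lam_less by (simp add: s1_def)
  have c0s2: "c0 * s2 = s1"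
    unfolding c0_def s1_def s2_def by (simp add: powr_add[symmetric] algebra_simps)
  let ?M = "r2 * - (d / (n + 1)) * - s1 + r1 * (c0 * (d / a)) * s2 + (1 - lam) powr \<beta>1 / (r * \<beta>1)"
  have "\<forall>\<^sub>F h in at_top. r2 * - (c5 h / h powr (n + 1)) * - s1 + r1 * (h powr a * c6 h) * s2
      + (1 - lam) powr \<beta>1 / (r * \<beta>1) = (v\<^sub>0 (y3 h) h - y3 h * vy (y3 h) h) / h powr \<beta>1"
    using pos
  proof eventually_elim
    case (elim h)
    have yp: "y3 h * y3 h powr (x - 1) = y3 h powr x" for x
      using y_pos(3)[OF elim] by (simp add: powr_mult_base)
    have "v\<^sub>0 (y3 h) h - y3 h * vy (y3 h) h =
        (1 - r1) * c5 h * y3 h powr r1 + (1 - r2) * c6 h * y3 h powr r2 + eT h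
        + r1 * c5 h * (y3 h powr r1 - y3 h * y3 h powr (r1 - 1))
        + r2 * c6 h * (y3 h powr r2 - y3 h * y3 h powr (r2 - 1))"
      unfolding vsol_third[OF y3_less_y2[OF elim]] branch_def branch'_def by (simp add: algebra_simps)
    then have v: "v\<^sub>0 (y3 h) h - y3 h * vy (y3 h) h =
        r2 * c5 h * y3 h powr r1 + r1 * c6 h * y3 h powr r2 + eT h"
      unfolding yp by (simp add: r2_eq)
    have e1: "(\<beta>1 - 1) * r1 = \<beta>1 - (n + 1)" "(\<beta>1 - 1) * r2 = \<beta>1 + a"
      by (simp_all add: n_def a_def r2_eq algebra_simps)
    have p: "y3 h powr r1 = h powr \<beta>1 / h powr (n + 1) * s1" "y3 h powr r2 = h powr \<beta>1 * h powr a * s2"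
      unfolding y3_powr[OF elim] e1 s1_def s2_def by (simp_all add: powr_diff powr_add)
    have t: "eT h = h powr \<beta>1 * ((1 - lam) powr \<beta>1 / (r * \<beta>1))"
      using elim lam_less by (simp add: eT_def powr_mult mult.commute)
    show ?case unfolding v p t using elim r_pos b1_pos
      by (simp add: field_simps)
  qed
  moreover have "((\<lambda>h. r2 * - (c5 h / h powr (n + 1)) * - s1 + r1 * (h powr a * c6 h) * s2
      + (1 - lam) powr \<beta>1 / (r * \<beta>1)) \<longlongrightarrow> ?M) at_top"
    by (intro tendsto_intros l5 l6)
  ultimately have lim: "((\<lambda>h. (v\<^sub>0 (y3 h) h - y3 h * vy (y3 h) h) / h powr \<beta>1) \<longlongrightarrow> ?M) at_top"
    by (rule Lim_transform_eventually[rotated])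
  have "(r1 - 1) / (n + 1) \<le> r1 / a"
    using a0 n0 r1_gt b1_pos unfolding n_eq by (intro frac_le) auto
  then have "0 \<le> d * s1 * (r1 / a - (r1 - 1) / (n + 1))"
    using d s by simp
  moreover have "?M = d * s1 * (r1 / a - (r1 - 1) / (n + 1)) + (1 - lam) powr \<beta>1 / (r * \<beta>1)"
    unfolding c0s2[symmetric] by (simp add: r2_eq algebra_simps diff_divide_distrib)
  moreover have "0 < (1 - lam) powr \<beta>1 / (r * \<beta>1)" using par by simp
  ultimately have "?M > 0" by linarith
  with lim show "\<exists>L>0. ((\<lambda>h. (v\<^sub>0 (y3 h) h - y3 h * vy (y3 h) h) / h powr \<beta>1) \<longlongrightarrow> L) at_top" by blast
qed

lemma y3_root: "h > 0 \<Longrightarrow> y3 h powr (1 / (\<beta>1 - 1)) = (1 - lam) powr (\<beta>1 / (\<beta>1 - 1)) * h"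
  using b1_less by (subst y3_powr) auto

lemma infinity_limits: assumes h: "h > 0"
  shows "((\<lambda>y. vy y h) \<longlongrightarrow> 0) at_top" "((\<lambda>y. y * vyy y h) \<longlongrightarrow> 0) at_top"
    "((\<lambda>y. v\<^sub>0 y h - y * vy y h) \<longlongrightarrow> eR h) at_top"
proof -
  have ev: "\<forall>\<^sub>F y in at_top. y > 0 \<and> y > y1 h"
    by (intro eventually_conj eventually_gt_at_top)
  have z1: "((\<lambda>y::real. y powr (r2 - 1)) \<longlongrightarrow> 0) at_top" and z2: "((\<lambda>y::real. y powr r2) \<longlongrightarrow> 0) at_top"
    using r2_neg by (auto intro!: tendsto_neg_powr filterlim_ident)
  have yp: "y * y powr (r2 - 1) = y powr r2" if "y > 0" for y :: real
    using that by (simp add: powr_mult_base)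
  have "\<forall>\<^sub>F y in at_top. r2 * c2 h * y powr (r2 - 1) = vy y h"
    using ev by eventually_elim (simp add: vy_def piecewise3_def branch'_def)
  moreover have "((\<lambda>y. r2 * c2 h * y powr (r2 - 1)) \<longlongrightarrow> 0) at_top"
    by (intro tendsto_mult_right_zero z1)
  ultimately show "((\<lambda>y. vy y h) \<longlongrightarrow> 0) at_top" by (rule Lim_transform_eventually[rotated])
  have "\<forall>\<^sub>F y in at_top. 2 * r / \<kappa>\<^sup>2 * c2 h * y powr (r2 - 1) = y * vyy y h"
    using ev
  proof eventually_elim
    case (elim y)
    then have "y * vyy y h = y * (2 / (\<kappa>\<^sup>2 * y\<^sup>2) * (r * (c2 h * (y * y powr (r2 - 1)))))"
      unfolding yp[OF conjunct1[OF elim]]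
      by (simp add: vyy_def piecewise3_def branch''_def branch_def branch_V_def algebra_simps)
    also have "\<dots> = 2 * r / \<kappa>\<^sup>2 * c2 h * y powr (r2 - 1)"
      using elim by (simp add: power2_eq_square)
    finally show ?case by simp
  qed
  moreover have "((\<lambda>y. 2 * r / \<kappa>\<^sup>2 * c2 h * y powr (r2 - 1)) \<longlongrightarrow> 0) at_top"
    by (intro tendsto_mult_right_zero z1)
  ultimately show "((\<lambda>y. y * vyy y h) \<longlongrightarrow> 0) at_top" by (rule Lim_transform_eventually[rotated])
  have "\<forall>\<^sub>F y in at_top. (1 - r2) * c2 h * y powr r2 + eR h = v\<^sub>0 y h - y * vy y h"
    using ev
  proof eventually_elim
    case (elim y)
    then have "v\<^sub>0 y h - y * vy y h = c2 h * y powr r2 + eR h - r2 * c2 h * (y * y powr (r2 - 1))"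
      by (simp add: vy_def vsol_eq piecewise3_def branch_def branch'_def)
    then show ?case unfolding yp[OF conjunct1[OF elim]] by (simp add: algebra_simps)
  qed
  moreover have "((\<lambda>y. (1 - r2) * c2 h * y powr r2 + eR h) \<longlongrightarrow> 0 + eR h) at_top"
    by (intro tendsto_intros tendsto_mult_right_zero z2)
  ultimately show "((\<lambda>y. v\<^sub>0 y h - y * vy y h) \<longlongrightarrow> eR h) at_top"
    using Lim_transform_eventually by fastforce
qed

text \<open>For \<open>s\<close> near \<open>h\<close> the point \<open>(Y3 h, s)\<close> stays in
  the third region. There the particular terms cancel because \<open>Y3 h\<close> is the derivative
  in \<open>h\<close> of \<open>((1 - lam) * h) powr \<beta>1 / \<beta>1\<close>, and the
  homogeneous terms cancel because the derivative of \<open>C6\<close> is minus that of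
  \<open>C5\<close> times \<open>Y3 h powr (r1 - r2)\<close>.\<close>

lemma free_boundary: assumes h: "h > 0"
  shows "((\<lambda>s. v\<^sub>0 (y3 h) s) has_real_derivative 0) (at h)"
proof -
  define Y where "Y = y3 h"
  have Y: "Y > 0" using y_pos(3)[OF h] by (simp add: Y_def)
  have "isCont y2 h" using y2_cont h by (simp add: continuous_on_eq_continuous_at)
  then have "(y2 \<longlongrightarrow> y2 h) (nhds h)" by (simp add: continuous_at tendsto_at_iff_tendsto_nhds)
  then have "\<forall>\<^sub>F s in nhds h. Y < y2 s"
    using y3_less_y2[OF h] unfolding Y_def by (rule order_tendstoD)
  then have ev: "\<forall>\<^sub>F s in nhds h. v\<^sub>0 Y s = solT s Y"
    by eventually_elim (rule vsol_third)
  have "((\<lambda>s. (1 / \<beta>1 * ((1 - lam) * s) powr \<beta>1) / r) has_real_derivative Y / r) (at h)"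
  proof -
    have "((\<lambda>s. ((1 - lam) * s) powr \<beta>1) has_real_derivative
        (1 - lam) * \<beta>1 * ((1 - lam) * h) powr (\<beta>1 - 1)) (at h)"
      using par h by (auto intro!: derivative_eq_intros)
    then have "((\<lambda>s. (1 / \<beta>1 * ((1 - lam) * s) powr \<beta>1) / r) has_real_derivative
        (1 / \<beta>1 * ((1 - lam) * \<beta>1 * ((1 - lam) * h) powr (\<beta>1 - 1))) / r) (at h)"
      by (intro DERIV_cdivide DERIV_cmult)
    moreover have "1 / \<beta>1 * ((1 - lam) * \<beta>1 * ((1 - lam) * h) powr (\<beta>1 - 1))
        = ((1 - lam) * (1 - lam) powr (\<beta>1 - 1)) * h powr (\<beta>1 - 1)"
      using par h by (simp add: powr_mult)
    moreover have "\<dots> = Y" using lam_less by (simp add: powr_mult_base Y_def y3_eq)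
    ultimately show ?thesis by simp
  qed
  then have dT: "(eT has_real_derivative Y / r) (at h)"
    by (simp add: eT_def[abs_def])
  have "Y powr r1 = Y powr (r1 - r2) * Y powr r2" by (simp add: powr_add[symmetric])
  also have "Y powr (r1 - r2) = c0 * h powr ((r1 - r2) * (\<beta>1 - 1))"
    unfolding Y_def y3_powr[OF h] c0_def by (simp add: mult.commute)
  finally have Yp: "Y powr r1 = c0 * h powr ((r1 - r2) * (\<beta>1 - 1)) * Y powr r2" .
  have dl: "((\<lambda>s. - (s / r) * Y) has_real_derivative - (1 / r) * Y) (at h)"
    using r_pos by (auto intro!: derivative_eq_intros)
  have "((\<lambda>s. c5 s * Y powr r1 + c6 s * Y powr r2 + eT s + - (s / r) * Y) has_real_derivative
      D5 h * Y powr r1 + - (c0 * D5 h * h powr ((r1 - r2) * (\<beta>1 - 1))) * Y powr r2 + Y / r + - (1 / r) * Y) (at h)"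
    by (intro DERIV_add DERIV_cmult_right c5_deriv[OF h] c6_deriv[OF h] dT dl)
  then have "((\<lambda>s. solT s Y) has_real_derivative 0) (at h)"
    unfolding Yp by (simp add: branch_def Yp algebra_simps)
  then show ?thesis
    unfolding Y_def[symmetric] using DERIV_cong_ev[OF refl ev refl] by simp
qed

lemma existence: "solves_off r \<kappa> k lam \<beta>1 \<beta>2 (\<lambda>h. {}) v\<^sub>0"
proof -
  have pos: "\<forall>\<^sub>F h::real in at_top. h > 0" by (rule eventually_gt_at_top)
  obtain L where L: "L < 0" "((\<lambda>h. vy (y3 h) h / h) \<longlongrightarrow> L) at_top"
    using boundary_limits(1) by blast
  obtain M where M: "M > 0" "((\<lambda>h. (v\<^sub>0 (y3 h) h - y3 h * vy (y3 h) h) / h powr \<beta>1) \<longlongrightarrow> M) at_top"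
    using boundary_limits(2) by blast
  have "filterlim (\<lambda>h. vy (y3 h) h / h * h) at_bot at_top"
    by (rule filterlim_tendsto_neg_mult_at_bot[OF L(2,1) filterlim_ident])
  moreover have "\<forall>\<^sub>F h in at_top. vy (y3 h) h / h * h = vy (y3 h) h"
    using pos by eventually_elim simp
  ultimately have a1: "filterlim (\<lambda>h. vy (y3 h) h) at_bot at_top"
    by (rule filterlim_cong[OF refl refl, THEN iffD1, rotated])
  have "filterlim (\<lambda>h. (v\<^sub>0 (y3 h) h - y3 h * vy (y3 h) h) / h powr \<beta>1 * h powr \<beta>1) at_top at_top"
    by (rule filterlim_tendsto_pos_mult_at_top[OF M(2,1) real_powr_at_top[OF b1_pos]])
  moreover have "\<forall>\<^sub>F h in at_top. (v\<^sub>0 (y3 h) h - y3 h * vy (y3 h) h) / h powr \<beta>1 * h powr \<beta>1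
      = v\<^sub>0 (y3 h) h - y3 h * vy (y3 h) h"
    using pos by eventually_elim simp
  ultimately have a2: "filterlim (\<lambda>h. v\<^sub>0 (y3 h) h - y3 h * vy (y3 h) h) at_top at_top"
    by (rule filterlim_cong[OF refl refl, THEN iffD1, rotated])
  \<comment> \<open>Since \<open>Y3 h powr (1 / (\<beta>1 - 1)) = e * h\<close>, the quotient in (b)
    is \<open>e / (vy / h)\<close>, and the constant there is \<open>- e / L\<close>.\<close>
  define e where "e = (1 - lam) powr (\<beta>1 / (\<beta>1 - 1))"
  have e: "e > 0" using lam_less by (simp add: e_def)
  have "((\<lambda>h. e / (vy (y3 h) h / h)) \<longlongrightarrow> e / L) at_top"
    using L by (intro tendsto_intros) auto
  moreover have "\<forall>\<^sub>F h in at_top. e / (vy (y3 h) h / h) = y3 h powr (1 / (\<beta>1 - 1)) / vy (y3 h) h"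
    using pos by eventually_elim (simp add: y3_root e_def)
  ultimately have "((\<lambda>h. y3 h powr (1 / (\<beta>1 - 1)) / vy (y3 h) h) \<longlongrightarrow> - (- e / L)) at_top"
    by (simp add: Lim_transform_eventually)
  then have b: "\<exists>c>0. ((\<lambda>h. y3 h powr (1 / (\<beta>1 - 1)) / vy (y3 h) h) \<longlongrightarrow> - c) at_top"
    using divide_neg_neg[of "- e" L] e L(1) by (intro exI[of _ "- e / L"]) (rule conjI; simp)
  have eR: "- (k / (r * \<beta>2)) * (lam * h) powr \<beta>2 = eR h" for h
    unfolding eR_def by simp
  show ?thesis
    unfolding solves_off_def
  proof (rule conjI[OF vsol_cont], rule exI[of _ vy], rule exI[of _ vyy], intro conjI allI impI ballI a1 a2 b)
    fix h :: real assume h: "h > 0"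
    show "((\<lambda>y. vy y h) \<longlongrightarrow> 0) at_top" "((\<lambda>y. y * vyy y h) \<longlongrightarrow> 0) at_top"
      "((\<lambda>y. v\<^sub>0 y h - y * vy y h) \<longlongrightarrow> - (k / (r * \<beta>2)) * (lam * h) powr \<beta>2) at_top"
      using infinity_limits[OF h] unfolding eR by auto
    show "((\<lambda>s. v\<^sub>0 (y3 h) s) has_real_derivative 0) (at h within {s. (y3 h, s) \<in> dom_yh lam \<beta>1})"
      by (rule has_field_derivative_at_within[OF free_boundary[OF h]])
    {
      fix y assume "y3 h \<le> y"
      then have y: "y > 0" using y_pos(3)[OF h] by simp
      show "((\<lambda>x. v\<^sub>0 x h) has_real_derivative vy y h) (at y within {y3 h..})"
        "((\<lambda>x. vy x h) has_real_derivative vyy y h) (at y within {y3 h..})"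
        using vsol_deriv[OF h y] vy_deriv[OF h y] by (auto intro: has_field_derivative_at_within)
      show "\<kappa>\<^sup>2 / 2 * y\<^sup>2 * vyy y h - r * v\<^sub>0 y h = - V y h" by (rule vsol_ode[OF y])
    }
    fix y assume "y \<in> {y1 h, y2 h}"
    then have y: "y > 0" using y_pos h by auto
    show "isCont (\<lambda>x. v\<^sub>0 x h) y" "isCont (\<lambda>x. vy x h) y"
      using vsol_deriv[OF h y] vy_deriv[OF h y] by (auto intro: DERIV_isCont)
  qed
qed

section \<open>Uniqueness\<close>

lemma y3_antimono: "0 < h \<Longrightarrow> h \<le> s \<Longrightarrow> y3 s \<le> y3 h"
  unfolding y3_eq using b1_less by (intro mult_right_mono powr_mono2') auto

lemma dom_iff: "h > 0 \<Longrightarrow> (y3 h, s) \<in> dom_yh lam \<beta>1 \<longleftrightarrow> s > 0 \<and> y3 s \<le> y3 h"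
  by (auto simp: dom_yh_def)

lemma two_solutions_differ:
  assumes h: "h > 0"
    and ode: "\<And>y. y3 h \<le> y \<Longrightarrow> y \<notin> {y1 h, y2 h} \<Longrightarrow>
           (w has_real_derivative wy y) (at y within {y3 h..}) \<and>
           (wy has_real_derivative wyy y) (at y within {y3 h..}) \<and>
           \<kappa>\<^sup>2 / 2 * y\<^sup>2 * wyy y - r * w y = - V y h"
    and inf: "(wy \<longlongrightarrow> 0) at_top" "((\<lambda>y. w y - y * wy y) \<longlongrightarrow> eR h) at_top"
    and fit: "\<And>y. y \<in> {y1 h, y2 h} \<Longrightarrow> isCont w y \<and> isCont wy y"
  shows "\<exists>B. \<forall>y\<ge>y3 h. w y = v\<^sub>0 y h + B * y powr r2 \<and> wy y = vy y h + r2 * B * y powr (r2 - 1)"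
proof -
  define f where "f y = w y - v\<^sub>0 y h" for y
  define f' where "f' y = wy y - vy y h" for y
  define f'' where "f'' y = wyy y - vyy y h" for y
  let ?a = "y3 h"
  have a: "?a > 0" using y_pos(3)[OF h] .
  have s: "r1 + r2 = 1" "r2 + r1 = 1" by (simp_all add: r2_eq)
  have v0: "((\<lambda>y. v\<^sub>0 y h) has_real_derivative vy y h) (at y within S)"
    "((\<lambda>y. vy y h) has_real_derivative vyy y h) (at y within S)" if "y \<ge> ?a" for y S
    using vsol_deriv[OF h, of y] vy_deriv[OF h, of y] that a
    by (auto intro: has_field_derivative_at_within)
  have d: "(f has_real_derivative f' y) (at y within {?a..})"
    "(f' has_real_derivative f'' y) (at y within {?a..})"
    if "y \<ge> ?a" "y \<notin> {y1 h, y2 h}" for y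
    unfolding f_def f'_def f''_def using ode[OF that] v0[OF that(1)] by (intro DERIV_diff; blast)+
  have "continuous (at y within {?a..}) f \<and> continuous (at y within {?a..}) f'" if y: "y \<ge> ?a" for y
  proof (cases "y \<in> {y1 h, y2 h}")
    case True
    have "continuous (at y within {?a..}) (\<lambda>y. v\<^sub>0 y h)" "continuous (at y within {?a..}) (\<lambda>y. vy y h)"
      using v0[OF y] by (auto intro: DERIV_continuous)
    moreover have "continuous (at y within {?a..}) w" "continuous (at y within {?a..}) wy"
      using fit[OF True] by (auto intro: continuous_at_imp_continuous_at_within)
    ultimately show ?thesis unfolding f_def f'_def by (intro conjI continuous_diff)
  next
    case False
    then show ?thesis using d[OF y] by (auto intro: DERIV_continuous)
  qed
  then have cont: "continuous_on {?a..} f" "continuous_on {?a..} f'"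
    by (auto simp: continuous_on_eq_continuous_within)
  have euler: "y\<^sup>2 * f'' y = - (r1 * r2) * f y" if "y \<ge> ?a" "y \<notin> {y1 h, y2 h}" for y
  proof -
    have "\<kappa>\<^sup>2 / 2 * y\<^sup>2 * vyy y h - r * v\<^sub>0 y h = - V y h"
      using that a by (intro vsol_ode) simp
    with ode[OF that] have "\<kappa>\<^sup>2 / 2 * (y\<^sup>2 * f'' y) = r * f y"
      unfolding f''_def f_def by (simp add: algebra_simps)
    then have "y\<^sup>2 * f'' y = (2 * r / \<kappa>\<^sup>2) * f y" using kappa_nz by (simp add: field_simps)
    then show ?thesis using r1_r2 by simp
  qed
  have fin: "finite {y1 h, y2 h}" by simp
  \<comment> \<open>The two invariants isolate the coefficients of \<open>y powr r1\<close> and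
    \<open>y powr r2\<close> in the difference.\<close>
  have inv1: "y powr (- r1) * (y * f' y - r2 * f y) = ?a powr (- r1) * (?a * f' ?a - r2 * f ?a)" if "y \<ge> ?a" for y
    by (rule euler_invariant[OF s(1) a fin cont d euler that])
  have inv2: "y powr (- r2) * (y * f' y - r1 * f y) = ?a powr (- r2) * (?a * f' ?a - r1 * f ?a)" if "y \<ge> ?a" for y
  proof (rule euler_invariant[OF s(2) a fin cont d _ that])
    show "y\<^sup>2 * f'' y = - (r2 * r1) * f y" if "y \<ge> ?a" "y \<notin> {y1 h, y2 h}" for y
      using euler[OF that] by (simp add: mult.commute)
  qed
  have "((\<lambda>y. wy y - vy y h) \<longlongrightarrow> 0 - 0) at_top"
    by (intro tendsto_diff inf infinity_limits[OF h])
  then have l1: "(f' \<longlongrightarrow> 0) at_top" by (simp add: f'_def[abs_def])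
  have "((\<lambda>y. (w y - y * wy y) - (v\<^sub>0 y h - y * vy y h)) \<longlongrightarrow> eR h - eR h) at_top"
    by (intro tendsto_diff inf infinity_limits[OF h])
  then have l2: "((\<lambda>y. f y - y * f' y) \<longlongrightarrow> 0) at_top"
    by (simp add: f_def f'_def algebra_simps)
  have p: "((\<lambda>y::real. y powr (1 - r1)) \<longlongrightarrow> 0) at_top" "((\<lambda>y::real. y powr (- r1)) \<longlongrightarrow> 0) at_top"
    using r1_gt by (auto intro!: tendsto_neg_powr filterlim_ident)
  \<comment> \<open>By \<open>r1 + r2 = 1\<close> the first invariant is this combination of the
    quantities controlled in (c). It tends to zero, so the constant is zero.\<close>
  have "((\<lambda>y. r1 * (y powr (1 - r1) * f' y) - r2 * (y powr (- r1) * (f y - y * f' y))) \<longlongrightarrow> r1 * (0 * 0) - r2 * (0 * 0)) at_top"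
    by (intro tendsto_intros l1 l2 p)
  moreover have "\<forall>\<^sub>F y in at_top. r1 * (y powr (1 - r1) * f' y) - r2 * (y powr (- r1) * (f y - y * f' y))
      = ?a powr (- r1) * (?a * f' ?a - r2 * f ?a)"
    using eventually_ge_at_top[of ?a]
  proof eventually_elim
    case (elim y)
    have "y powr (1 - r1) = y * y powr (- r1)" using elim a by (simp add: powr_mult_base)
    then have "r1 * (y powr (1 - r1) * f' y) - r2 * (y powr (- r1) * (f y - y * f' y))
        = y powr (- r1) * (y * f' y - r2 * f y)"
      by (simp add: r2_eq algebra_simps)
    then show ?case using inv1[OF elim] by simp
  qed
  ultimately have "((\<lambda>y::real. ?a powr (- r1) * (?a * f' ?a - r2 * f ?a)) \<longlongrightarrow> 0) at_top"
    using Lim_transform_eventually[of "\<lambda>y. r1 * (y powr (1 - r1) * f' y) - r2 * (y powr (- r1) * (f y - y * f' y))"]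
    by simp
  then have "?a powr (- r1) * (?a * f' ?a - r2 * f ?a) = 0"
    by (simp add: tendsto_const_iff)
  then have f': "y * f' y = r2 * f y" if "y \<ge> ?a" for y
    using inv1[OF that] that a by simp
  define B where "B = ?a powr (- r2) * f ?a"
  have "w y = v\<^sub>0 y h + B * y powr r2 \<and> wy y = vy y h + r2 * B * y powr (r2 - 1)" if y: "y \<ge> ?a" for y
  proof -
    have y0: "y > 0" using y a by simp
    have "(r2 - r1) * (y powr (- r2) * f y) = (r2 - r1) * B"
      using inv2[OF y] unfolding f'[OF y] f'[OF order_refl] B_def by (simp add: algebra_simps)
    then have B: "y powr (- r2) * f y = B" using r1_minus_r2 by simp
    have "f y = (y powr (- r2) * f y) * y powr r2"
      using y0 by (simp add: powr_minus)
    then have fy: "f y = B * y powr r2" unfolding B .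
    have "y * f' y = y * (r2 * B * y powr (r2 - 1))"
      unfolding f'[OF y] fy using y0 by (simp add: powr_mult_base mult.left_commute)
    then have "f' y = r2 * B * y powr (r2 - 1)" using y0 by simp
    with fy show ?thesis by (simp add: f_def f'_def)
  qed
  then show ?thesis by blast
qed

lemma uniqueness:
  assumes sol: "solves_off r \<kappa> k lam \<beta>1 \<beta>2 (\<lambda>h. {y1 h, y2 h}) v"
    and h: "h > 0" and y: "y3 h \<le> y"
  shows "v y h = v\<^sub>0 y h"
proof -
  have cv: "continuous_on (dom_yh lam \<beta>1) (\<lambda>(y, h). v y h)"
    using sol by (simp add: solves_off_def)
  obtain wy wyy c where
    ode': "\<forall>h>0. \<forall>y\<ge>y3 h. y \<notin> {y1 h, y2 h} \<longrightarrow>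
           ((\<lambda>x. v x h) has_real_derivative wy y h) (at y within {y3 h..}) \<and>
           ((\<lambda>x. wy x h) has_real_derivative wyy y h) (at y within {y3 h..}) \<and>
           \<kappa>\<^sup>2 / 2 * y\<^sup>2 * wyy y h - r * v y h = - V y h"
    and bot: "filterlim (\<lambda>h. wy (y3 h) h) at_bot at_top"
    and c: "0 < c" "((\<lambda>h. y3 h powr (1 / (\<beta>1 - 1)) / wy (y3 h) h) \<longlongrightarrow> - c) at_top"
    and inf': "\<forall>h>0. ((\<lambda>y. wy y h) \<longlongrightarrow> 0) at_top \<and> ((\<lambda>y. y * wyy y h) \<longlongrightarrow> 0) at_top \<and>
      ((\<lambda>y. v y h - y * wy y h) \<longlongrightarrow> - (k / (r * \<beta>2)) * (lam * h) powr \<beta>2) at_top"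
    and free': "\<forall>h>0. ((\<lambda>s. v (y3 h) s) has_real_derivative 0) (at h within {s. (y3 h, s) \<in> dom_yh lam \<beta>1})"
    and fit': "\<forall>h>0. \<forall>y\<in>{y1 h, y2 h}. isCont (\<lambda>x. v x h) y \<and> isCont (\<lambda>x. wy x h) y"
    using sol unfolding solves_off_def by (elim conjE exE) (rule that)
  note ode = ode'[rule_format] and fit = fit'[rule_format] and free = free'[rule_format]
  have inf: "((\<lambda>y. wy y h) \<longlongrightarrow> 0) at_top"
    "((\<lambda>y. v y h - y * wy y h) \<longlongrightarrow> - (k / (r * \<beta>2)) * (lam * h) powr \<beta>2) at_top" if "h > 0" for h
    using inf' that by auto
  have eR: "- (k / (r * \<beta>2)) * (lam * h) powr \<beta>2 = eR h" for h
    unfolding eR_def by simp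
  have "\<exists>B. \<forall>y\<ge>y3 h. v y h = v\<^sub>0 y h + B * y powr r2 \<and> wy y h = vy y h + r2 * B * y powr (r2 - 1)"
    if h: "h > 0" for h
    by (rule two_solutions_differ[OF h ode[OF h] inf(1)[OF h] inf(2)[OF h, unfolded eR] fit[OF h]])
  then obtain B where B: "\<And>h y. h > 0 \<Longrightarrow> y \<ge> y3 h \<Longrightarrow> v y h = v\<^sub>0 y h + B h * y powr r2"
      "\<And>h y. h > 0 \<Longrightarrow> y \<ge> y3 h \<Longrightarrow> wy y h = vy y h + r2 * B h * y powr (r2 - 1)"
    by metis
  have B_eq: "B s = (v y s - v\<^sub>0 y s) * y powr (- r2)" if "s > 0" "y \<ge> y3 s" for s y
    using B(1)[OF that] that y_pos(3)[OF that(1)] by (simp add: powr_minus)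
  have c3: "continuous_on {0<..} y3"
    unfolding Y3_def[abs_def] by (intro continuous_intros) auto
  have on_y3: "continuous_on {0<..} (\<lambda>h. u (y3 h) h)" if "continuous_on (dom_yh lam \<beta>1) (\<lambda>(y, h). u y h)"
    for u :: "real \<Rightarrow> real \<Rightarrow> real"
  proof -
    have "continuous_on {0<..} (\<lambda>h. (\<lambda>(y, h). u y h) (y3 h, h))"
      by (rule continuous_on_compose2[OF that]) (auto intro!: continuous_intros c3 simp: dom_yh_def)
    then show ?thesis by simp
  qed
  have "continuous_on {0<..} (\<lambda>h. (v (y3 h) h - v\<^sub>0 (y3 h) h) * y3 h powr (- r2))"
  proof -
    have "\<forall>h\<in>{0<..}. y3 h \<noteq> 0" using y_pos(3) by force
    then show ?thesis
      by (intro continuous_on_mult continuous_on_diff continuous_on_powr continuous_on_const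
          on_y3[OF cv] on_y3[OF vsol_cont] c3)
  qed
  then have cB: "continuous_on {0<..} B"
    by (rule continuous_on_eq) (rule B_eq[symmetric]; simp)
  have dB: "(B has_real_derivative 0) (at h within {h..})" if h: "h > 0" for h
  proof -
    have sub: "{h..} \<subseteq> {s. (y3 h, s) \<in> dom_yh lam \<beta>1}"
      using h y3_antimono[OF h] by (auto simp: dom_iff[OF h])
    have "((\<lambda>s. (v (y3 h) s - v\<^sub>0 (y3 h) s) * y3 h powr (- r2)) has_real_derivative (0 - 0) * y3 h powr (- r2))
        (at h within {h..})"
      by (intro DERIV_cmult_right DERIV_diff DERIV_subset[OF free[OF h] sub]
          has_field_derivative_at_within[OF free_boundary[OF h]])
    then have "((\<lambda>s. (v (y3 h) s - v\<^sub>0 (y3 h) s) * y3 h powr (- r2)) has_real_derivative 0) (at h within {h..})"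
      by simp
    then show ?thesis
    proof (rule has_field_derivative_transform_within[where d = 1])
      show "(v (y3 h) s - v\<^sub>0 (y3 h) s) * y3 h powr (- r2) = B s" if "s \<in> {h..}" for s
        using that h y3_antimono[OF h] by (intro B_eq[symmetric]) auto
    qed simp_all
  qed
  have step: "B t = B s" if "0 < s" "s < t" for s t
  proof (rule right_deriv_zero_const[OF that(2)])
    show "continuous_on {s..t} B"
      by (rule continuous_on_subset[OF cB]) (use that in auto)
    show "(B has_real_derivative 0) (at x within {x..})" if "s \<le> x" for x
      using that \<open>0 < s\<close> by (intro dB) simp
  qed
  define b where "b = B 1"
  have Bb: "B s = b" if "s > 0" for s
    using step[OF that, of 1] step[OF zero_less_one, of s] unfolding b_def by (metis linorder_neqE_linordered_idom)
  have pos: "\<forall>\<^sub>F h::real in at_top. h > 0" by (rule eventually_gt_at_top)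
  obtain L where L: "L < 0" "((\<lambda>h. vy (y3 h) h / h) \<longlongrightarrow> L) at_top"
    using boundary_limits(1) by blast
  define a where "a = (1 - \<beta>1) * r1 - 1"
  have a: "a > 0" using exponent_gt by (simp add: a_def)
  define q where "q = (1 - lam) powr (\<beta>1 * (r2 - 1))"
  have q: "q > 0" using lam_less by (simp add: q_def)
  \<comment> \<open>On \<open>Y3\<close> the extra term in the derivative is of order
    \<open>h powr (a + 1)\<close> with \<open>a > 0\<close>, and so outgrows the order
    \<open>h\<close> of \<open>vy\<close>.\<close>
  have split: "\<forall>\<^sub>F h in at_top. vy (y3 h) h / h + (r2 * b * q) * h powr a = wy (y3 h) h / h"
    using pos
  proof eventually_elim
    case (elim h)
    have e: "(\<beta>1 - 1) * (r2 - 1) = a + 1" by (simp add: a_def r2_eq algebra_simps)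
    have "y3 h powr (r2 - 1) = h * h powr a * q"
      unfolding y3_powr[OF elim] e q_def using elim by (simp add: powr_add)
    then show ?case
      unfolding B(2)[OF elim order_refl] Bb[OF elim] using elim by (simp add: field_simps)
  qed
  have top: "filterlim (\<lambda>h::real. h powr a) at_top at_top"
    using a by (rule real_powr_at_top)
  \<comment> \<open>If \<open>b < 0\<close>, the derivative becomes positive along
    \<open>Y3\<close>, against (a). If \<open>b > 0\<close>, it falls faster than any multiple of
    \<open>h\<close>, and the quotient in (b) tends to 0 instead of \<open>- c\<close>.\<close>
  have "b = 0"
  proof (rule ccontr)
    assume "b \<noteq> 0"
    then consider "b < 0" | "b > 0" by linarith
    then show False
    proof cases
      case 1
      then have "r2 * b * q > 0" using r2_neg q by (simp add: mult_neg_neg)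
      then have "filterlim (\<lambda>h. (r2 * b * q) * h powr a) at_top at_top"
        by (rule filterlim_tendsto_pos_mult_at_top[OF tendsto_const _ top])
      then have "filterlim (\<lambda>h. vy (y3 h) h / h + (r2 * b * q) * h powr a) at_top at_top"
        by (rule filterlim_tendsto_add_at_top[OF L(2)])
      then have "\<forall>\<^sub>F h in at_top. 0 < vy (y3 h) h / h + (r2 * b * q) * h powr a"
        by (simp add: filterlim_at_top_dense)
      moreover have "\<forall>\<^sub>F h in at_top. wy (y3 h) h < 0"
        using bot by (simp add: filterlim_at_bot_dense)
      ultimately have "\<forall>\<^sub>F h::real in at_top. False"
        using split pos by eventually_elim (simp add: zero_less_divide_iff)
      then show False by simp
    next
      case 2
      then have neg: "- (r2 * b * q) > 0" using r2_neg q by (simp add: mult_neg_pos)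
      have "filterlim (\<lambda>h. - (r2 * b * q) * h powr a) at_top at_top"
        by (rule filterlim_tendsto_pos_mult_at_top[OF tendsto_const neg top])
      then have "filterlim (\<lambda>h. - (vy (y3 h) h / h) + - (r2 * b * q) * h powr a) at_top at_top"
        by (rule filterlim_tendsto_add_at_top[OF tendsto_minus[OF L(2)]])
      moreover have "\<forall>\<^sub>F h in at_top. - (vy (y3 h) h / h) + - (r2 * b * q) * h powr a = - (wy (y3 h) h / h)"
        using split by eventually_elim (simp add: algebra_simps)
      ultimately have "filterlim (\<lambda>h. - (wy (y3 h) h / h)) at_top at_top"
        by (rule filterlim_cong[OF refl refl, THEN iffD1, rotated])
      then have "filterlim (\<lambda>h. wy (y3 h) h / h) at_bot at_top"
        by (simp add: filterlim_uminus_at_bot)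
      then have "filterlim (\<lambda>h. wy (y3 h) h / h) at_infinity at_top"
        by (rule filterlim_mono) (simp_all add: at_bot_le_at_infinity)
      then have "((\<lambda>h. (1 - lam) powr (\<beta>1 / (\<beta>1 - 1)) / (wy (y3 h) h / h)) \<longlongrightarrow> 0) at_top"
        by (rule tendsto_divide_0[OF tendsto_const])
      moreover have "\<forall>\<^sub>F h in at_top. (1 - lam) powr (\<beta>1 / (\<beta>1 - 1)) / (wy (y3 h) h / h)
          = y3 h powr (1 / (\<beta>1 - 1)) / wy (y3 h) h"
        using pos by eventually_elim (simp add: y3_root)
      ultimately have "((\<lambda>h. y3 h powr (1 / (\<beta>1 - 1)) / wy (y3 h) h) \<longlongrightarrow> 0) at_top"
        by (rule Lim_transform_eventually)
      with c(2) have "- c = 0" by (rule tendsto_unique[rotated]) simp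
      with c(1) show False by simp
    qed
  qed
  then show ?thesis using B(1)[OF h y] Bb[OF h] by simp
qed

end

text \<open>\<open>deriv\<close> and \<open>integral\<close> are total, so the first conjunct
  ensures that the formula for \<open>C6\<close> involves no default values. Existence is asserted
  for the equation at every point, uniqueness in the larger class where it may fail on the two
  curves.\<close>

theorem proposition3p1:
  fixes r \<mu> \<sigma> \<kappa> k lam \<beta>1 \<beta>2 r1 r2 :: real
  assumes "r > 0" and "\<mu> > r" and "\<sigma> > 0" and "\<kappa> = (\<mu> - r) / \<sigma>"
    and "k > 0" and "0 < lam" and "lam < 1"
    and "0 < \<beta>1" and "\<beta>1 < 1" and "0 < \<beta>2" and "\<beta>2 < 1"
    and "r1 > 1" and "r1\<^sup>2 - r1 - 2 * r / \<kappa>\<^sup>2 = 0"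
    and "r2 < 0" and "r2\<^sup>2 - r2 - 2 * r / \<kappa>\<^sup>2 = 0"
    and "\<beta>1 < - r2 / r1" and "\<beta>2 < - r2 / r1"
  shows "(\<forall>h>0. C5 r r1 r2 k lam \<beta>1 \<beta>2 differentiable (at h)
              \<and> C6_integrand r r1 r2 k lam \<beta>1 \<beta>2 integrable_on {h..})
       \<and> solves_off r \<kappa> k lam \<beta>1 \<beta>2 (\<lambda>h. {}) (vsol r \<kappa> r1 r2 k lam \<beta>1 \<beta>2)
       \<and> (\<forall>v. solves_off r \<kappa> k lam \<beta>1 \<beta>2
                 (\<lambda>h. {Y1 k lam \<beta>1 \<beta>2 h, Y2 k lam \<beta>1 \<beta>2 h}) v
              \<longrightarrow> (\<forall>h>0. \<forall>y \<ge> Y3 lam \<beta>1 h. v y h = vsol r \<kappa> r1 r2 k lam \<beta>1 \<beta>2 y h))"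
proof -
  \<comment> \<open>The difference of the two quadratic equations; as the roots have opposite signs,
    their sum is 1.\<close>
  have "(r1 - r2) * (r1 + r2 - 1) = 0"
    using assms(13,15) by (simp add: power2_eq_square algebra_simps)
  then have r2: "r2 = 1 - r1" using assms(12,14) by auto
  have "r1 * r2 = - 2 * r / \<kappa>\<^sup>2"
    using assms(13) unfolding r2 by (simp add: power2_eq_square algebra_simps)
  then interpret dual_problem r \<kappa> k lam \<beta>1 \<beta>2 r1 r2
    using assms r2 by unfold_locales auto
  show ?thesis
  proof (intro conjI allI impI)
    fix h :: real assume h: "h > 0"
    show "C5 r r1 r2 k lam \<beta>1 \<beta>2 differentiable (at h)"
      using c5_deriv[OF h] by (auto simp: real_differentiable_def)
    show "C6_integrand r r1 r2 k lam \<beta>1 \<beta>2 integrable_on {h..}"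
      by (rule integrand_integrable[OF h])
  qed (use existence uniqueness in auto)
qed

end
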